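(* Let $p\in\mathbb C[z,w]$ be an irreducible inner toral polynomial of bidegree $(n,m)$, let $\alpha$ be a positive integer, and let $\mathcal K$ be a rank $\alpha$-admissible kernel over $\mathfrak V(p)$, with associated matrix polynomials $Q$ (of size $\alpha\times m\alpha$) and $P$ (of size $\alpha\times n\alpha$). Then (i) the operator $X$ determined by $X\mathcal K_{(\lambda,\mu)}\gamma=\overline{\lambda}\,\mathcal K_{(\lambda,\mu)}\gamma$ is bounded on the linear span of $\{\mathcal K_y\gamma: y\in\mathfrak V(p),\ \gamma\in\mathbb C^\alpha\}$; (ii) for each $1\le j\le m\alpha$ and each positive integer $k$, the vector $z^kQe_j$ ($Qe_j$ being the $j$-th column of $Q$) lies in $H^2(\mathcal K)$; (iii) the span of $\{s_\lambda Q(\lambda,\mu)^*\gamma: (\lambda,\mu)\in\mathfrak V(p),\ \gamma\in\mathbb C^\alpha\}$ is dense in $H^2_{\mathbb C^{m\alpha}}$; (iv) the set $\mathscr B=\{z^kQe_j: k\in\mathbb N,\ 1\le j\le m\alpha\}$ is an orthonormal basis for $H^2(\mathcal K)$; and (v) the operators $S$ and $T$ densely defined on (the span of) $\mathscr B$ by $Sf=zf$ and $Tf=wf$ extend to a pair of pure isometries on $H^2(\mathcal K)$.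
   Context: Let $\mathbb D$, $\mathbb T$, $\mathbb E$ be the open unit disk, the unit circle, and the complement of the closed unit disk in $\mathbb C$; $\mathbb N$ denotes the non-negative integers. $Z(p)$ is the zero set of $p$; $p$ is inner toral if $Z(p)\subset\mathbb D^2\cup\mathbb T^2\cup\mathbb E^2$; $\mathfrak V(p)=Z(p)\cap\mathbb D^2$. Bidegree $(n,m)$ means degree $n$ in $z$ and degree $m$ in $w$. A rank $\alpha$-admissible kernel $\mathcal K$ over $\mathfrak V(p)$ consists of an $\alpha\times m\alpha$ matrix polynomial $Q$ and an $\alpha\times n\alpha$ matrix polynomial $P$ such that $$\frac{Q(z,w)Q(\zeta,\eta)^*}{1-z\overline{\zeta}}=\mathcal K((z,w),(\zeta,\eta))=\frac{P(z,w)P(\zeta,\eta)^*}{1-w\overline{\eta}},\qquad (z,w),(\zeta,\eta)\in\mathfrak V(p),$$ where $Q$ and $P$ have full rank $\alpha$ at some point of $\mathfrak V(p)$. $H^2(\mathcal K)$ is the reproducing kernel Hilbert space of $\mathbb C^\alpha$-valued functions on $\mathfrak V(p)$ associated with $\mathcal K$; $\mathcal K_y(x)=\mathcal K(x,y)$, so the span of $\{\mathcal K_y\gamma\}$ is dense in $H^2(\mathcal K)$ and $\langle f,\mathcal K_y\gamma\rangle=\langle f(y),\gamma\rangle$. Polynomial vectors such as $z^kQe_j$ are regarded as functions on $\mathfrak V(p)$. $H^2_{\mathbb C^{M}}$ is the Hardy space of $\mathbb C^{M}$-valued functions on $\mathbb D$, and $s_\lambda(z)=1/(1-\overline{\lambda}z)$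 is the Szegő kernel. An isometry $S$ on $H$ is pure if $\bigcap_{j\ge1}S^jH=\{0\}$. *)

theory Defs
  imports
    "HOL-Complex_Analysis.Complex_Analysis"
    "HOL-Library.Function_Algebras"
    "HOL-Computational_Algebra.Polynomial_Factorial"
begin

section \<open>Polynomials in two variables and inner toral curves\<close>

text \<open>
  \<open>\<complex>[z,w]\<close> is represented as \<open>\<complex>[z][w]\<close>, the type \<^typ>\<open>complex poly poly\<close>:
  the outer indeterminate is \<open>w\<close> and the coefficients are polynomials in \<open>z\<close>.
\<close>

definition eval2 :: "complex poly poly \<Rightarrow> complex \<times> complex \<Rightarrow> complex" where
  "eval2 p x = poly (poly p [:snd x:]) (fst x)"

definition deg_z :: "complex poly poly \<Rightarrow> nat" where
  "deg_z p = Max ((\<lambda>i. degree (coeff p i)) ` {..degree p})"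

definition deg_w :: "complex poly poly \<Rightarrow> nat" where
  "deg_w p = degree p"

definition bidegree :: "complex poly poly \<Rightarrow> nat \<times> nat" where
  "bidegree p = (deg_z p, deg_w p)"

definition zero_set :: "complex poly poly \<Rightarrow> (complex \<times> complex) set" where
  "zero_set p = {x. eval2 p x = 0}"

abbreviation unit_disk :: "complex set" where
  "unit_disk \<equiv> ball 0 1"

definition inner_toral :: "complex poly poly \<Rightarrow> bool" where
  "inner_toral p \<longleftrightarrow>
     zero_set p \<subseteq> unit_disk \<times> unit_disk \<union> sphere 0 1 \<times> sphere 0 1
                  \<union> (- cball 0 1) \<times> (- cball 0 1)"

definition disk_variety :: "complex poly poly \<Rightarrow> (complex \<times> complex) set" where
  "disk_variety p = zero_set p \<inter> unit_disk \<times> unit_disk"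


section \<open>Complex matrices and matrix polynomials\<close>

definition cinner :: "complex^'n \<Rightarrow> complex^'n \<Rightarrow> complex" where
  "cinner u v = (\<Sum>i\<in>UNIV. u $ i * cnj (v $ i))"

definition cadjoint :: "complex^'n^'m \<Rightarrow> complex^'m^'n" where
  "cadjoint A = map_matrix cnj (transpose A)"

definition meval :: "complex poly poly^'n^'m \<Rightarrow> complex \<times> complex \<Rightarrow> complex^'n^'m" where
  "meval A x = map_matrix (\<lambda>q. eval2 q x) A"

text \<open>
  The row index type \<open>'a\<close> has \<open>\<alpha>\<close> elements. The kernel is only constrained on
  \<open>\<VV>(p) \<times> \<VV>(p)\<close>, and none of the definitions below looks at its other values.
\<close>

definition admissible_kernel ::
  "complex poly poly \<Rightarrow> complex poly poly^'q^'a \<Rightarrow> complex poly poly^'r^'a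
   \<Rightarrow> (complex \<times> complex \<Rightarrow> complex \<times> complex \<Rightarrow> complex^'a^'a) \<Rightarrow> bool" where
  "admissible_kernel p Q P K \<longleftrightarrow>
     CARD('q) = deg_w p * CARD('a) \<and> CARD('r) = deg_z p * CARD('a) \<and>
     (\<forall>x\<in>disk_variety p. \<forall>y\<in>disk_variety p.
        map_matrix (\<lambda>c. c / (1 - fst x * cnj (fst y))) (meval Q x ** cadjoint (meval Q y)) = K x y \<and>
        K x y = map_matrix (\<lambda>c. c / (1 - snd x * cnj (snd y))) (meval P x ** cadjoint (meval P y))) \<and>
     (\<exists>x\<in>disk_variety p. rank (meval Q x) = CARD('a) \<and> rank (meval P x) = CARD('a))"


section \<open>Hilbert spaces of vector-valued functions\<close>

text \<open>
  A function on a set \<open>V\<close> is represented by its extension by \<open>0\<close> to the whole type, so that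
  functions that agree on \<open>V\<close> are equal and the pointwise operations make the functions on \<open>V\<close>
  a complex vector space.
\<close>

definition restr :: "'x set \<Rightarrow> ('x \<Rightarrow> complex^'n) \<Rightarrow> 'x \<Rightarrow> complex^'n" where
  "restr V f = (\<lambda>x. if x \<in> V then f x else 0)"

definition fscale :: "complex \<Rightarrow> ('x \<Rightarrow> complex^'n) \<Rightarrow> 'x \<Rightarrow> complex^'n" where
  "fscale c f = (\<lambda>x. c *s f x)"

definition fmult :: "('x \<Rightarrow> complex) \<Rightarrow> ('x \<Rightarrow> complex^'n) \<Rightarrow> 'x \<Rightarrow> complex^'n" where
  "fmult g f = (\<lambda>x. g x *s f x)"

interpretation cfun: vector_space "fscale :: complex \<Rightarrow> ('x \<Rightarrow> complex^'n) \<Rightarrow> 'x \<Rightarrow> complex^'n"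
  by unfold_locales
    (simp_all add: fscale_def fun_eq_iff vec_eq_iff algebra_simps)

type_synonym ('x, 'n) fun_ip = "('x \<Rightarrow> complex^'n) \<Rightarrow> ('x \<Rightarrow> complex^'n) \<Rightarrow> complex"

definition ip_norm :: "('x, 'n) fun_ip \<Rightarrow> ('x \<Rightarrow> complex^'n) \<Rightarrow> real" where
  "ip_norm ip f = sqrt (Re (ip f f))"

locale hilbert_function_space =
  fixes H :: "('x \<Rightarrow> complex^'n) set" and ip :: "('x, 'n::finite) fun_ip"
  assumes subspace: "cfun.subspace H"
    and ip_add: "\<And>f g h. f \<in> H \<Longrightarrow> g \<in> H \<Longrightarrow> h \<in> H \<Longrightarrow> ip (f + g) h = ip f h + ip g h"
    and ip_scale: "\<And>c f g. f \<in> H \<Longrightarrow> g \<in> H \<Longrightarrow> ip (fscale c f) g = c * ip f g"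
    and ip_commute: "\<And>f g. f \<in> H \<Longrightarrow> g \<in> H \<Longrightarrow> ip g f = cnj (ip f g)"
    and ip_nonneg: "\<And>f. f \<in> H \<Longrightarrow> Re (ip f f) \<ge> 0"
    and ip_definite: "\<And>f. f \<in> H \<Longrightarrow> ip f f = 0 \<Longrightarrow> f = 0"
    and complete: "\<And>F :: nat \<Rightarrow> 'x \<Rightarrow> complex^'n. (\<And>k. F k \<in> H) \<Longrightarrow>
          (\<And>e. e > 0 \<Longrightarrow> \<exists>N. \<forall>k\<ge>N. \<forall>l\<ge>N. ip_norm ip (F k - F l) < e) \<Longrightarrow>
          \<exists>f\<in>H. (\<lambda>k. ip_norm ip (F k - f)) \<longlonglongrightarrow> 0"

definition dense_in :: "('x \<Rightarrow> complex^'n) set \<Rightarrow> ('x, 'n) fun_ip \<Rightarrow> ('x \<Rightarrow> complex^'n) set \<Rightarrow> bool" where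
  "dense_in H ip D \<longleftrightarrow> D \<subseteq> H \<and> (\<forall>f\<in>H. \<forall>e>0. \<exists>g\<in>D. ip_norm ip (f - g) < e)"

text \<open>
  Orthonormal bases are families, so the vectors belonging to different indices are distinct.
\<close>

definition orthonormal_basis ::
  "('x \<Rightarrow> complex^'n) set \<Rightarrow> ('x, 'n) fun_ip \<Rightarrow> ('i \<Rightarrow> 'x \<Rightarrow> complex^'n) \<Rightarrow> bool" where
  "orthonormal_basis H ip b \<longleftrightarrow>
     range b \<subseteq> H \<and> (\<forall>i j. ip (b i) (b j) = (if i = j then 1 else 0)) \<and>
     dense_in H ip (cfun.span (range b))"

definition linear_on ::
  "('x \<Rightarrow> complex^'n) set \<Rightarrow> (('x \<Rightarrow> complex^'n) \<Rightarrow> 'x \<Rightarrow> complex^'n) \<Rightarrow> bool" where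
  "linear_on D X \<longleftrightarrow>
     (\<forall>f\<in>D. \<forall>g\<in>D. X (f + g) = X f + X g) \<and> (\<forall>c. \<forall>f\<in>D. X (fscale c f) = fscale c (X f))"

definition bounded_on ::
  "('x \<Rightarrow> complex^'n) set \<Rightarrow> ('x, 'n) fun_ip \<Rightarrow> (('x \<Rightarrow> complex^'n) \<Rightarrow> 'x \<Rightarrow> complex^'n) \<Rightarrow> bool" where
  "bounded_on D ip X \<longleftrightarrow> (\<exists>C. \<forall>f\<in>D. ip_norm ip (X f) \<le> C * ip_norm ip f)"

definition isometry_on ::
  "('x \<Rightarrow> complex^'n) set \<Rightarrow> ('x, 'n) fun_ip \<Rightarrow> (('x \<Rightarrow> complex^'n) \<Rightarrow> 'x \<Rightarrow> complex^'n) \<Rightarrow> bool" where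
  "isometry_on H ip S \<longleftrightarrow>
     S ` H \<subseteq> H \<and> linear_on H S \<and> (\<forall>f\<in>H. ip_norm ip (S f) = ip_norm ip f)"

definition pure_isometry_on ::
  "('x \<Rightarrow> complex^'n) set \<Rightarrow> ('x, 'n) fun_ip \<Rightarrow> (('x \<Rightarrow> complex^'n) \<Rightarrow> 'x \<Rightarrow> complex^'n) \<Rightarrow> bool" where
  "pure_isometry_on H ip S \<longleftrightarrow> isometry_on H ip S \<and> (\<Inter>j\<in>{1..}. (S ^^ j) ` H) = {0}"


section \<open>The reproducing kernel Hilbert space and the Hardy space\<close>

definition kernel_fun ::
  "'x set \<Rightarrow> ('x \<Rightarrow> 'x \<Rightarrow> complex^'n^'n) \<Rightarrow> 'x \<Rightarrow> complex^'n \<Rightarrow> 'x \<Rightarrow> complex^'n" where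
  "kernel_fun V K y \<gamma> = restr V (\<lambda>x. K x y *v \<gamma>)"

text \<open>
  \<open>rkhs V K H ip\<close> says that \<open>H\<close> with inner product \<open>ip\<close> is the reproducing kernel Hilbert space
  on \<open>V\<close> with kernel \<open>K\<close>; these conditions determine \<open>H\<close>, and \<open>ip\<close> on \<open>H\<close>, uniquely.
\<close>

locale rkhs = hilbert_function_space H ip
  for V :: "'x set" and K :: "'x \<Rightarrow> 'x \<Rightarrow> complex^'n^'n"
    and H :: "('x \<Rightarrow> complex^'n::finite) set" and ip :: "('x, 'n) fun_ip" +
  assumes vanishes_outside: "\<And>f x. f \<in> H \<Longrightarrow> x \<notin> V \<Longrightarrow> f x = 0"
    and kernel_in: "\<And>y \<gamma>. y \<in> V \<Longrightarrow> kernel_fun V K y \<gamma> \<in> H"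
    and reproducing: "\<And>f y \<gamma>. f \<in> H \<Longrightarrow> y \<in> V \<Longrightarrow> ip f (kernel_fun V K y \<gamma>) = cinner (f y) \<gamma>"

text \<open>
  The vector-valued Hardy space on the disk: holomorphic functions with square-summable Taylor
  coefficients at \<open>0\<close>.
\<close>

definition taylor_coeff :: "(complex \<Rightarrow> complex^'n::finite) \<Rightarrow> nat \<Rightarrow> complex^'n" where
  "taylor_coeff f k = (\<chi> i. (deriv ^^ k) (\<lambda>z. f z $ i) 0 / fact k)"

definition hardy_space :: "(complex \<Rightarrow> complex^'n::finite) set" where
  "hardy_space = {f. (\<forall>i. (\<lambda>z. f z $ i) holomorphic_on unit_disk) \<and>
                     (\<forall>z. z \<notin> unit_disk \<longrightarrow> f z = 0) \<and>
                     summable (\<lambda>k. (norm (taylor_coeff f k))\<^sup>2)}"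

definition hardy_ip :: "(complex, 'n::finite) fun_ip" where
  "hardy_ip f g = (\<Sum>k. cinner (taylor_coeff f k) (taylor_coeff g k))"

definition szego :: "complex \<Rightarrow> complex \<Rightarrow> complex" where
  "szego l z = 1 / (1 - cnj l * z)"

text \<open>The column vector polynomial \<open>z\<^sup>k Q e\<^sub>j\<close> as a function on \<open>V\<close>.\<close>

definition zQ ::
  "(complex \<times> complex) set \<Rightarrow> complex poly poly^'q^'a \<Rightarrow> nat \<Rightarrow> 'q \<Rightarrow> complex \<times> complex \<Rightarrow> complex^'a" where
  "zQ V Q k j = restr V (\<lambda>x. fst x ^ k *s column j (meval Q x))"

end

theory Submission
  imports Defs
    "HOL-Computational_Algebra.Field_as_Ring"
    "HOL-Computational_Algebra.Fundamental_Theorem_Algebra"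
begin

text \<open>
  The proof identifies \<open>H\<^sup>2(K)\<close> with a vector-valued Hardy space. The first factorization of the
  kernel says that
  \<open>\<langle>s\<^sub>\<lambda> Q(\<lambda>,\<mu>)\<^sup>* \<gamma>, s\<^sub>\<zeta> Q(\<zeta>,\<eta>)\<^sup>* \<delta>\<rangle> = \<langle>K\<^bsub>(\<lambda>,\<mu>)\<^esub> \<gamma>, K\<^bsub>(\<zeta>,\<eta>)\<^esub> \<delta>\<rangle>\<close>, so
  \<open>s\<^sub>\<lambda> Q(\<lambda>,\<mu>)\<^sup>* \<gamma> \<mapsto> K\<^bsub>(\<lambda>,\<mu>)\<^esub> \<gamma>\<close> preserves inner products. If the vectors on the left are dense
  in the Hardy space, it extends to a unitary operator, which is \<open>f \<mapsto> Q f\<close>. This operator maps the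
  standard basis to the vectors \<open>z\<^sup>k Q e\<^sub>j\<close> and intertwines the shift with multiplication by \<open>z\<close>,
  which is therefore a pure isometry; its adjoint is the operator \<open>X\<close>.

  Everything thus rests on the density. A function \<open>f\<close> orthogonal to all those vectors satisfies
  \<open>Q(\<lambda>,\<mu>) f(\<lambda>) = 0\<close> on the curve, and it has to be shown that \<open>f(\<lambda>) = 0\<close> for all but finitely
  many \<open>\<lambda>\<close>. Because the curve is irreducible and inner toral, a generic fibre over \<open>\<lambda>\<close> consists of
  exactly \<open>m\<close> points \<open>(\<lambda>,\<mu>\<^sub>i)\<close>, all with \<open>\<mu>\<^sub>i\<close> in the disk (lemma \<open>generic_fst_fibre\<close>), and \<open>P\<close> has
  full rank at all of them (lemma \<open>full_rank_off_finite\<close>). The matrices \<open>Q(\<lambda>,\<mu>\<^sub>i)\<close> stacked on top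
  of each other form a square matrix, and the second factorization of the kernel shows that its
  rows have the Gram matrix
  \<open>(1 - \<bar>\<lambda>\<bar>\<^sup>2) P(\<lambda>,\<mu>\<^sub>i) P(\<lambda>,\<mu>\<^sub>j)\<^sup>* / (1 - \<mu>\<^sub>i \<mu>\<^sub>j\<^sup>*)\<close>, which is positive definite since the \<open>\<mu>\<^sub>i\<close> are
  distinct and the \<open>P(\<lambda>,\<mu>\<^sub>i)\<close> have full rank (lemma \<open>szego_gram_definite\<close>). So the stacked matrix is invertible
  (lemma \<open>fibre_separates\<close>).

  The same argument with the two variables and the roles of \<open>P\<close> and \<open>Q\<close> exchanged shows that
  multiplication by \<open>w\<close> is a pure isometry. For this reason the operator theory is developed for a
  kernel factored along an unspecified coordinate, in the locale \<open>szego_factored_rkhs\<close>.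
\<close>

section \<open>Hilbert spaces of functions\<close>

context hilbert_function_space
begin

lemma zero_in: "0 \<in> H" using cfun.subspace_0[OF subspace] .
lemma add_in: "f \<in> H \<Longrightarrow> g \<in> H \<Longrightarrow> f + g \<in> H" using cfun.subspace_add[OF subspace] .
lemma scale_in: "f \<in> H \<Longrightarrow> fscale c f \<in> H" using cfun.subspace_scale[OF subspace] .
lemma diff_in: "f \<in> H \<Longrightarrow> g \<in> H \<Longrightarrow> f - g \<in> H" using cfun.subspace_diff[OF subspace] .

lemma span_in: "D \<subseteq> H \<Longrightarrow> cfun.span D \<subseteq> H"
  using cfun.span_minimal[OF _ subspace] .

lemma diff_conv_scale: "f - g = f + fscale (-1) (g :: 'x \<Rightarrow> complex^'n)"
  by (simp add: fun_eq_iff fscale_def vec_eq_iff)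

lemma ip_diff: "f \<in> H \<Longrightarrow> g \<in> H \<Longrightarrow> h \<in> H \<Longrightarrow> ip (f - g) h = ip f h - ip g h"
  unfolding diff_conv_scale[of f g] by (simp only: ip_add ip_scale scale_in) simp

lemma ip_add_right: "f \<in> H \<Longrightarrow> g \<in> H \<Longrightarrow> h \<in> H \<Longrightarrow> ip h (f + g) = ip h f + ip h g"
  by (metis add_in complex_cnj_add ip_add ip_commute)

lemma ip_diff_right: "f \<in> H \<Longrightarrow> g \<in> H \<Longrightarrow> h \<in> H \<Longrightarrow> ip h (f - g) = ip h f - ip h g"
  by (metis diff_in complex_cnj_diff ip_diff ip_commute)

lemma ip_scale_right: "f \<in> H \<Longrightarrow> h \<in> H \<Longrightarrow> ip h (fscale c f) = cnj c * ip h f"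
  by (metis scale_in complex_cnj_mult ip_scale ip_commute)

lemma ip_zero: "f \<in> H \<Longrightarrow> ip 0 f = 0"
  using ip_diff[of f f f] by simp

lemma ip_zero_right: "f \<in> H \<Longrightarrow> ip f 0 = 0"
  using ip_diff_right[of f f f] by simp

lemma sum_in: "(\<And>i. i \<in> A \<Longrightarrow> F i \<in> H) \<Longrightarrow> sum F A \<in> H"
  using cfun.subspace_sum[OF subspace] .

lemma ip_sum_right:
  assumes f: "f \<in> H" and F: "\<And>i. i \<in> A \<Longrightarrow> F i \<in> H"
  shows "ip f (sum F A) = (\<Sum>i\<in>A. ip f (F i))"
  using F
proof (induction A rule: infinite_finite_induct)
  case (insert x A)
  have "ip f (sum F (insert x A)) = ip f (F x + sum F A)"
    by (rule arg_cong[where f = "ip f", OF sum.insert[OF insert(1,2)]])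
  also have "\<dots> = ip f (F x) + ip f (sum F A)"
    using insert(4) by (intro ip_add_right f sum_in) auto
  also have "\<dots> = (\<Sum>i\<in>insert x A. ip f (F i))" using insert by simp
  finally show ?case .
next
  case (infinite A)
  show ?case unfolding sum.infinite[OF infinite(1)] by (rule ip_zero_right[OF f])
next
  case empty
  show ?case unfolding sum.empty by (rule ip_zero_right[OF f])
qed

lemma norm_nonneg: "f \<in> H \<Longrightarrow> 0 \<le> ip_norm ip f"
  by (simp add: ip_norm_def ip_nonneg)

lemma norm_square: "f \<in> H \<Longrightarrow> (ip_norm ip f)\<^sup>2 = Re (ip f f)"
  by (simp add: ip_norm_def ip_nonneg)

lemma ip_self: "f \<in> H \<Longrightarrow> ip f f = of_real ((ip_norm ip f)\<^sup>2)"
  using ip_commute[of f f] by (simp add: norm_square complex_eq_iff)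

lemma norm_eq_0_iff: "f \<in> H \<Longrightarrow> ip_norm ip f = 0 \<longleftrightarrow> f = 0"
  using ip_self[of f] ip_definite[of f] ip_zero[of 0] zero_in by (auto simp: ip_norm_def)

text \<open>
  Subtracting from \<open>u\<close> its component along \<open>e\<close> lowers the squared norm by
  \<open>\<bar>\<langle>u, e\<rangle>\<bar>\<^sup>2 / \<parallel>e\<parallel>\<^sup>2\<close>, which cannot bring it below \<open>d\<^sup>2\<close>. So a vector whose norm nearly
  realises its distance to \<open>D\<close> is nearly orthogonal to \<open>D\<close>. The Cauchy-Schwarz inequality is the
  case \<open>D = H\<close>, \<open>d = 0\<close>, and the density criterion below uses minimizing sequences.
\<close>

lemma near_minimizer_near_orthogonal:
  assumes u: "u \<in> H" and D: "cfun.subspace D" "D \<subseteq> H" and e: "e \<in> D"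
    and lower: "\<And>v. v \<in> D \<Longrightarrow> d\<^sup>2 \<le> (ip_norm ip (u - v))\<^sup>2"
    and upper: "(ip_norm ip u)\<^sup>2 \<le> d\<^sup>2 + \<epsilon>\<^sup>2" and "0 \<le> \<epsilon>"
  shows "cmod (ip u e) \<le> \<epsilon> * ip_norm ip e"
proof (cases "e = 0")
  case True
  then show ?thesis using ip_zero_right[OF u] norm_nonneg[OF zero_in] \<open>0 \<le> \<epsilon>\<close> by simp
next
  case False
  have eH: "e \<in> H" using D e by auto
  define t where "t = (ip_norm ip e)\<^sup>2"
  have t: "t > 0" "ip e e = of_real t"
    using False eH norm_eq_0_iff[OF eH] ip_self[OF eH] by (auto simp: t_def)
  define c where "c = ip u e / of_real t"
  have ceD: "fscale c e \<in> D" using D e cfun.subspace_scale by blast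
  have ceH: "fscale c e \<in> H" using ceD D by auto
  have "ip (u - fscale c e) (u - fscale c e) = ip u u - cnj c * ip u e - c * (ip e u - cnj c * ip e e)"
    using u eH ceH
    by (simp add: ip_diff ip_diff_right ip_scale ip_scale_right diff_in algebra_simps)
  also have "ip e u = cnj (ip u e)" by (rule ip_commute[OF u eH])
  also have "cnj (ip u e) - cnj c * ip e e = 0" using t by (simp add: c_def)
  also have "cnj c * ip u e = of_real ((cmod (ip u e))\<^sup>2 / t)"
    using complex_norm_square[of "ip u e"] by (simp add: c_def mult.commute[of "cnj _"])
  finally have "complex_of_real ((ip_norm ip (u - fscale c e))\<^sup>2) =
      of_real ((ip_norm ip u)\<^sup>2 - (cmod (ip u e))\<^sup>2 / t)"
    unfolding ip_self[OF u] ip_self[OF diff_in[OF u ceH]] by (simp only: of_real_diff) simp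
  then have "(ip_norm ip (u - fscale c e))\<^sup>2 = (ip_norm ip u)\<^sup>2 - (cmod (ip u e))\<^sup>2 / t"
    unfolding of_real_eq_iff .
  with lower[OF ceD] upper have "(cmod (ip u e))\<^sup>2 / t \<le> \<epsilon>\<^sup>2" by linarith
  then have "(cmod (ip u e))\<^sup>2 \<le> (\<epsilon> * ip_norm ip e)\<^sup>2"
    using t(1) by (simp add: field_simps t_def power_mult_distrib)
  then show ?thesis
    using \<open>0 \<le> \<epsilon>\<close> norm_nonneg[OF eH] power2_le_imp_le by (meson mult_nonneg_nonneg)
qed

lemma cauchy_schwarz:
  "f \<in> H \<Longrightarrow> g \<in> H \<Longrightarrow> cmod (ip f g) \<le> ip_norm ip f * ip_norm ip g"
  using near_minimizer_near_orthogonal[OF _ subspace order_refl, of f g 0 "ip_norm ip f"] norm_nonneg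
  by simp

lemma norm_triangle:
  assumes "f \<in> H" "g \<in> H"
  shows "ip_norm ip (f + g) \<le> ip_norm ip f + ip_norm ip g"
proof -
  have "ip (f + g) (f + g) = ip f f + ip g g + (ip f g + cnj (ip f g))"
    using assms ip_commute[of f g] by (simp add: ip_add ip_add_right add_in)
  then have "(ip_norm ip (f + g))\<^sup>2 = (ip_norm ip f)\<^sup>2 + (ip_norm ip g)\<^sup>2 + 2 * Re (ip f g)"
    using assms by (simp add: norm_square add_in)
  also have "\<dots> \<le> (ip_norm ip f)\<^sup>2 + (ip_norm ip g)\<^sup>2 + 2 * (ip_norm ip f * ip_norm ip g)"
    using cauchy_schwarz[OF assms] complex_Re_le_cmod[of "ip f g"] by linarith
  also have "\<dots> = (ip_norm ip f + ip_norm ip g)\<^sup>2" by (simp add: power2_sum)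
  finally show ?thesis
    using assms norm_nonneg power2_le_imp_le by (meson add_nonneg_nonneg)
qed

lemma norm_scale:
  assumes "f \<in> H" shows "ip_norm ip (fscale c f) = cmod c * ip_norm ip f"
proof -
  have "ip (fscale c f) (fscale c f) = of_real ((cmod c)\<^sup>2) * ip f f"
    using assms complex_norm_square[of c]
    by (simp add: ip_scale ip_scale_right scale_in mult.assoc[symmetric])
  then show ?thesis
    by (simp add: ip_norm_def real_sqrt_mult)
qed

lemma norm_minus_commute: "f \<in> H \<Longrightarrow> g \<in> H \<Longrightarrow> ip_norm ip (f - g) = ip_norm ip (g - f)"
  using norm_scale[of "g - f" "-1"] diff_in[of g f]
  by (simp add: fscale_def fun_diff_def)

lemma norm_diff_triangle:
  "f \<in> H \<Longrightarrow> g \<in> H \<Longrightarrow> h \<in> H \<Longrightarrow>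
    ip_norm ip (f - h) \<le> ip_norm ip (f - g) + ip_norm ip (g - h)"
  using norm_triangle[of "f - g" "g - h"] by (simp add: diff_in)

lemma ip_tendsto:
  assumes F: "\<And>k. F k \<in> H" and f: "f \<in> H" and g: "g \<in> H"
    and lim: "(\<lambda>k. ip_norm ip (F k - f)) \<longlonglongrightarrow> 0"
  shows "(\<lambda>k. ip (F k) g) \<longlonglongrightarrow> ip f g"
proof -
  have "(\<lambda>k. ip_norm ip (F k - f) * ip_norm ip g) \<longlonglongrightarrow> 0 * ip_norm ip g"
    by (intro tendsto_mult lim tendsto_const)
  then have bound_lim: "(\<lambda>k. ip_norm ip (F k - f) * ip_norm ip g) \<longlonglongrightarrow> 0" by simp
  have bound: "\<forall>k. cmod (ip (F k) g - ip f g) \<le> ip_norm ip (F k - f) * ip_norm ip g"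
    using cauchy_schwarz[OF diff_in[OF F f] g] unfolding ip_diff[OF F f g] by blast
  have "(\<lambda>k. ip (F k) g - ip f g) \<longlonglongrightarrow> 0"
    by (rule Lim_null_comparison[OF always_eventually[OF bound] bound_lim])
  then show ?thesis by (simp add: LIM_zero_iff)
qed

text \<open>
  For \<open>f \<in> H\<close>, take a sequence in \<open>D\<close> whose distances to \<open>f\<close> approach the infimum. By
  near-orthogonality it is a Cauchy sequence, and its limit \<open>g\<close> has \<open>f - g\<close> orthogonal to \<open>D\<close>; so
  \<open>f = g\<close>.
\<close>

lemma dense_if_orthogonal_complement_trivial:
  assumes D: "cfun.subspace D" "D \<subseteq> H"
    and triv: "\<And>f. f \<in> H \<Longrightarrow> (\<And>g. g \<in> D \<Longrightarrow> ip f g = 0) \<Longrightarrow> f = 0"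
  shows "dense_in H ip D"
  unfolding dense_in_def
proof (intro conjI ballI allI impI)
  show "D \<subseteq> H" by fact
  fix f and e :: real assume f: "f \<in> H" and e: "e > (0::real)"
  define A where "A = (\<lambda>g. (ip_norm ip (f - g))\<^sup>2) ` D"
  define d where "d = sqrt (Inf A)"
  have A: "A \<noteq> {}" "bdd_below A"
    using cfun.subspace_0[OF D(1)] by (auto simp: A_def intro!: bdd_belowI[of _ 0])
  have "Inf A \<ge> 0" using A by (intro cInf_greatest) (auto simp: A_def)
  then have d2: "d\<^sup>2 = Inf A" by (simp add: d_def)
  define \<epsilon> where "\<epsilon> k = inverse (real (Suc k))" for k
  have \<epsilon>: "\<epsilon> k > 0" for k by (simp add: \<epsilon>_def)
  have lower: "d\<^sup>2 \<le> (ip_norm ip (f - g))\<^sup>2" if "g \<in> D" for g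
    unfolding d2 using A that by (intro cInf_lower) (auto simp: A_def)
  have "\<exists>g\<in>D. (ip_norm ip (f - g))\<^sup>2 < d\<^sup>2 + (\<epsilon> k)\<^sup>2" for k
    using cInf_lessD[OF A(1), of "d\<^sup>2 + (\<epsilon> k)\<^sup>2"] \<epsilon>[of k] by (auto simp: d2 A_def)
  then obtain G where G: "\<And>k. G k \<in> D" "\<And>k. (ip_norm ip (f - G k))\<^sup>2 < d\<^sup>2 + (\<epsilon> k)\<^sup>2"
    by metis
  have GH: "G k \<in> H" for k using G(1) D(2) by auto
  have near: "cmod (ip (f - G k) g) \<le> \<epsilon> k * ip_norm ip g" if g: "g \<in> D" for g k
  proof (rule near_minimizer_near_orthogonal[OF _ D g])
    fix v assume "v \<in> D"
    then show "d\<^sup>2 \<le> (ip_norm ip (f - G k - v))\<^sup>2"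
      using lower[of "G k + v"] cfun.subspace_add[OF D(1) G(1)] by (simp add: algebra_simps)
  qed (use f GH diff_in G(2)[of k] \<epsilon>[of k] in auto)
  have cauchy: "ip_norm ip (G k - G l) \<le> \<epsilon> k + \<epsilon> l" for k l
  proof -
    let ?h = "G k - G l"
    have hD: "?h \<in> D" and hH: "?h \<in> H"
      using cfun.subspace_diff[OF D(1) G(1) G(1)] D(2) by auto
    have "of_real ((ip_norm ip ?h)\<^sup>2) = ip (f - G l) ?h - ip (f - G k) ?h"
      unfolding ip_self[OF hH, symmetric] ip_diff[OF f GH hH] ip_diff[OF GH GH hH] by simp
    then have "(ip_norm ip ?h)\<^sup>2 = cmod (ip (f - G l) ?h - ip (f - G k) ?h)"
      by (metis norm_of_real abs_of_nonneg zero_le_power2)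
    also have "\<dots> \<le> \<epsilon> l * ip_norm ip ?h + \<epsilon> k * ip_norm ip ?h"
      by (intro order_trans[OF norm_triangle_ineq4] add_mono near hD)
    finally have "ip_norm ip ?h * ip_norm ip ?h \<le> (\<epsilon> k + \<epsilon> l) * ip_norm ip ?h"
      by (simp add: power2_eq_square algebra_simps)
    then show ?thesis
      using norm_nonneg[OF hH] \<epsilon>[of k] \<epsilon>[of l]
      by (cases "ip_norm ip ?h = 0") (auto simp: mult_le_cancel_right)
  qed
  have \<epsilon>_lim: "\<epsilon> \<longlonglongrightarrow> 0" unfolding \<epsilon>_def by (rule LIMSEQ_inverse_real_of_nat)
  have "\<exists>N. \<forall>k\<ge>N. \<forall>l\<ge>N. ip_norm ip (G k - G l) < r" if "r > 0" for r
  proof -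
    have "eventually (\<lambda>k. \<epsilon> k < r / 2) sequentially"
      using order_tendstoD(2)[OF \<epsilon>_lim, of "r / 2"] that by simp
    then obtain N where N: "\<And>k. k \<ge> N \<Longrightarrow> \<epsilon> k < r / 2"
      unfolding eventually_sequentially by blast
    have "ip_norm ip (G k - G l) < r" if "k \<ge> N" "l \<ge> N" for k l
      using cauchy[of k l] N[OF that(1)] N[OF that(2)] by linarith
    then show ?thesis by blast
  qed
  from complete[OF GH this] obtain g where g: "g \<in> H" and lim: "(\<lambda>k. ip_norm ip (G k - g)) \<longlonglongrightarrow> 0"
    by blast
  have "f - g = 0"
  proof (rule triv)
    fix h assume h: "h \<in> D"
    then have hH: "h \<in> H" using D by auto
    have "(\<lambda>k. ip f h - ip (G k) h) \<longlonglongrightarrow> ip f h - ip g h"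
      by (intro tendsto_diff tendsto_const ip_tendsto GH g hH lim)
    moreover have "(\<lambda>k. ip f h - ip (G k) h) \<longlonglongrightarrow> 0"
    proof (rule Lim_null_comparison[OF always_eventually])
      show "\<forall>k. cmod (ip f h - ip (G k) h) \<le> \<epsilon> k * ip_norm ip h"
        using near[OF h] by (simp add: ip_diff f GH hH)
      show "(\<lambda>k. \<epsilon> k * ip_norm ip h) \<longlonglongrightarrow> 0"
        using tendsto_mult[OF \<epsilon>_lim tendsto_const[of "ip_norm ip h"]] by simp
    qed
    ultimately have "ip f h - ip g h = 0" by (rule LIMSEQ_unique)
    then show "ip (f - g) h = 0" using f g hH by (simp add: ip_diff)
  qed (use f g diff_in in auto)
  then have "f = g" by simp
  obtain k where "ip_norm ip (G k - g) < e"
    using order_tendstoD(2)[OF lim e] by (auto simp: eventually_sequentially)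
  then show "\<exists>g\<in>D. ip_norm ip (f - g) < e"
    using G(1)[of k] \<open>f = g\<close> norm_minus_commute[OF GH f] by auto
qed

end

section \<open>The inner product of complex vectors\<close>

lemma cinner_add: "cinner (u + v) w = cinner u w + cinner v w"
  by (simp add: cinner_def ring_distribs sum.distrib)

lemma cinner_add_right: "cinner w (u + v) = cinner w u + cinner w v"
  by (simp add: cinner_def ring_distribs sum.distrib)

lemma cinner_scale: "cinner (c *s u) v = c * cinner u v"
  by (simp add: cinner_def sum_distrib_left mult.assoc)

lemma cinner_scale_right: "cinner u (c *s v) = cnj c * cinner u v"
  by (simp add: cinner_def sum_distrib_left mult_ac)

lemma cinner_zero [simp]: "cinner 0 u = 0" "cinner u 0 = 0"
  by (simp_all add: cinner_def)

lemma cinner_sum: "cinner (sum f A) v = (\<Sum>x\<in>A. cinner (f x) v)"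
  by (induction A rule: infinite_finite_induct) (simp_all add: cinner_add)

lemma cinner_commute: "cinner v u = cnj (cinner u v)"
  by (simp add: cinner_def mult.commute)

lemma cinner_axis [simp]: "cinner u (axis i 1) = u $ i"
  by (simp add: cinner_def axis_def if_distrib[of cnj] if_distrib[of "(*) _"] cong: if_cong)

lemma cinner_eqI: "(\<And>w. cinner u w = cinner v w) \<Longrightarrow> u = v"
  by (metis cinner_axis vec_eq_iff)

lemma cinner_self: "cinner u u = of_real ((norm u)\<^sup>2)"
  by (simp add: cinner_def norm_vec_def L2_set_def sum_nonneg complex_norm_square[symmetric])

lemma cinner_bound: "cmod (cinner u v) \<le> norm u * norm v"
proof -
  have "cmod (cinner u v) \<le> (\<Sum>i\<in>UNIV. \<bar>cmod (u $ i)\<bar> * \<bar>cmod (v $ i)\<bar>)"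
    unfolding cinner_def by (rule order_trans[OF norm_sum]) (simp add: norm_mult)
  also have "\<dots> \<le> norm u * norm v"
    unfolding norm_vec_def by (rule L2_set_mult_ineq)
  finally show ?thesis .
qed

lemma cinner_adjoint: "cinner (A *v u) v = cinner u (cadjoint A *v v)"
  by (simp add: cinner_def cadjoint_def matrix_vector_mult_def transpose_def map_matrix_def
      sum_distrib_left sum_distrib_right mult_ac sum.swap[of _ "UNIV :: 'a set"])

lemma map_matrix_divide_mult: "map_matrix (\<lambda>t. t / d) M *v v = (1 / d) *s (M *v v)"
  for d :: complex
  by (simp add: vec_eq_iff matrix_vector_mult_def sum_divide_distrib)

lemma matrix_vector_mult_sum_right: "A *v (\<Sum>x\<in>S. f x) = (\<Sum>x\<in>S. A *v f x)"
  for A :: "complex^'n^'m"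
  by (induction S rule: infinite_finite_induct) (simp_all add: matrix_vector_right_distrib)

lemma matrix_vector_mult_axis: "A *v axis j 1 = column j A"
  for A :: "complex^'n^'m"
  by (simp add: vec_eq_iff matrix_vector_mult_def column_def axis_def if_distrib[of "(*) _"] cong: if_cong)

lemma sum_fun_apply: "(\<Sum>i\<in>A. f i) x = (\<Sum>i\<in>A. f i x)"
  for f :: "'i \<Rightarrow> 'x \<Rightarrow> complex^'n"
  by (induction A rule: infinite_finite_induct) simp_all

section \<open>The Hardy space\<close>

lemma norm_vector_scale: "norm (c *s (v :: complex^'n)) = cmod c * norm v"
  by (simp add: norm_vec_def L2_set_right_distrib norm_mult)

lemma square_summable_add:
  fixes a b :: "nat \<Rightarrow> complex^'n"
  assumes "summable (\<lambda>k. (norm (a k))\<^sup>2)" "summable (\<lambda>k. (norm (b k))\<^sup>2)"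
  shows "summable (\<lambda>k. (norm (a k + b k))\<^sup>2)"
proof (rule summable_comparison_test')
  show "summable (\<lambda>k. 2 * (norm (a k))\<^sup>2 + 2 * (norm (b k))\<^sup>2)"
    by (intro summable_add summable_mult assms)
  fix k :: nat
  have "(norm (a k + b k))\<^sup>2 \<le> (norm (a k) + norm (b k))\<^sup>2"
    by (intro power_mono norm_triangle_ineq) auto
  also have "\<dots> \<le> 2 * (norm (a k))\<^sup>2 + 2 * (norm (b k))\<^sup>2"
    using sum_squares_bound[of "norm (a k)" "norm (b k)"] by (simp add: power2_sum)
  finally show "norm ((norm (a k + b k))\<^sup>2) \<le> 2 * (norm (a k))\<^sup>2 + 2 * (norm (b k))\<^sup>2"
    by simp
qed

lemma square_summable_scale:
  fixes a :: "nat \<Rightarrow> complex^'n"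
  assumes "summable (\<lambda>k. (norm (a k))\<^sup>2)"
  shows "summable (\<lambda>k. (norm (c *s a k))\<^sup>2)"
  using summable_mult[OF assms, of "(cmod c)\<^sup>2"]
  by (simp add: norm_vector_scale power_mult_distrib)

text \<open>
  A form of the inequality of arithmetic and geometric means that turns products of
  square-summable sequences into summable ones without any constants.
\<close>

lemma product_le_squares: "x * y \<le> x\<^sup>2 + y\<^sup>2" for x y :: real
  using sum_squares_bound[of x y] zero_le_power2[of x] zero_le_power2[of y] unfolding mult.assoc by linarith

lemma square_summable_power_series:
  fixes a :: "nat \<Rightarrow> complex^'n"
  assumes "summable (\<lambda>k. (norm (a k))\<^sup>2)" and "cmod z < 1"
  shows "summable (\<lambda>k. a k $ i * z ^ k)"
proof (rule summable_comparison_test')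
  show "summable (\<lambda>k. (norm (a k))\<^sup>2 + ((cmod z)\<^sup>2) ^ k)"
    using assms by (intro summable_add summable_geometric) (auto simp: power_less_one_iff abs_square_less_1)
  fix k :: nat
  have "norm (a k $ i * z ^ k) \<le> norm (a k) * cmod z ^ k"
    unfolding norm_mult norm_power by (intro mult_right_mono Finite_Cartesian_Product.norm_nth_le) simp
  also have "\<dots> \<le> (norm (a k))\<^sup>2 + ((cmod z)\<^sup>2) ^ k"
    using product_le_squares[of "norm (a k)" "cmod z ^ k"]
    by (simp add: power_mult[symmetric] mult.commute)
  finally show "norm (a k $ i * z ^ k) \<le> (norm (a k))\<^sup>2 + ((cmod z)\<^sup>2) ^ k" .
qed

lemma power_series_taylor_unique:
  assumes "\<And>z. z \<in> unit_disk \<Longrightarrow> (\<lambda>k. b k * z ^ k) sums g z"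
  shows "(deriv ^^ k) g 0 / fact k = b k"
proof -
  have "eventually (\<lambda>z. z \<in> unit_disk) (nhds (0 :: complex))"
    by (intro eventually_nhds_in_open) auto
  then have "eventually (\<lambda>z. (\<lambda>k. b k * z ^ k) sums g z) (nhds 0)"
    by eventually_elim (rule assms)
  then have "g has_fps_expansion Abs_fps b"
    by (intro has_fps_expansionI) simp
  from fps_nth_fps_expansion[OF this, of k] show ?thesis by simp
qed

lemma hardy_sums:
  assumes "f \<in> hardy_space" "z \<in> unit_disk"
  shows "(\<lambda>k. taylor_coeff f k $ i * z ^ k) sums (f z $ i)"
  using holomorphic_power_series[of "\<lambda>z. f z $ i" 0 1 z] assms
  by (auto simp: hardy_space_def taylor_coeff_def)

lemma hardy_outside: "f \<in> hardy_space \<Longrightarrow> z \<notin> unit_disk \<Longrightarrow> f z = 0"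
  by (simp add: hardy_space_def)

lemma hardy_summable: "f \<in> hardy_space \<Longrightarrow> summable (\<lambda>k. (norm (taylor_coeff f k))\<^sup>2)"
  by (simp add: hardy_space_def)

text \<open>
  Membership in the Hardy space is always established by exhibiting the coefficients; this also
  identifies them with the derivatives at the origin.
\<close>

lemma hardy_spaceI:
  fixes f :: "complex \<Rightarrow> complex^'n" and a :: "nat \<Rightarrow> complex^'n"
  assumes sums: "\<And>z i. z \<in> unit_disk \<Longrightarrow> (\<lambda>k. a k $ i * z ^ k) sums (f z $ i)"
    and outside: "\<And>z. z \<notin> unit_disk \<Longrightarrow> f z = 0"
    and summable: "summable (\<lambda>k. (norm (a k))\<^sup>2)"
  shows "f \<in> hardy_space" and "taylor_coeff f = a"
proof -
  show T: "taylor_coeff f = a"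
  proof
    fix k
    have "(deriv ^^ k) (\<lambda>z. f z $ i) 0 / fact k = a k $ i" for i
      by (rule power_series_taylor_unique) (rule sums)
    then show "taylor_coeff f k = a k" by (simp add: taylor_coeff_def vec_eq_iff)
  qed
  have "(\<lambda>z. f z $ i) holomorphic_on unit_disk" for i
    using sums[of _ i] by (intro power_series_holomorphic[where a = "\<lambda>k. a k $ i"]) simp
  then show "f \<in> hardy_space"
    using outside summable by (simp add: hardy_space_def T)
qed

lemma hardy_eqI:
  assumes "f \<in> hardy_space" "g \<in> hardy_space" "taylor_coeff f = taylor_coeff g"
  shows "f = g"
proof
  fix z
  show "f z = g z"
  proof (cases "z \<in> unit_disk")
    case True
    then have "f z $ i = g z $ i" for i
      using hardy_sums[OF assms(1) True, of i] hardy_sums[OF assms(2) True, of i] assms(3) sums_unique2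
      by metis
    then show ?thesis by (simp add: vec_eq_iff)
  qed (simp add: hardy_outside assms)
qed

lemma hardy_of_coeffs:
  fixes a :: "nat \<Rightarrow> complex^'n"
  assumes "summable (\<lambda>k. (norm (a k))\<^sup>2)"
  obtains f where "f \<in> hardy_space" "taylor_coeff f = a"
proof -
  define f where "f = restr unit_disk (\<lambda>z. \<chi> i. \<Sum>k. a k $ i * z ^ k)"
  have "(\<lambda>k. a k $ i * z ^ k) sums (f z $ i)" if "z \<in> unit_disk" for z i
    using that summable_sums[OF square_summable_power_series[OF assms, of z i]]
    by (simp add: f_def restr_def)
  moreover have "f z = 0" if "z \<notin> unit_disk" for z using that by (simp add: f_def restr_def)
  ultimately show ?thesis using hardy_spaceI[of a f] assms that by blast
qed

lemma
  fixes f g :: "complex \<Rightarrow> complex^'n"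
  assumes "f \<in> hardy_space" "g \<in> hardy_space"
  shows hardy_add: "f + g \<in> hardy_space"
    and taylor_coeff_add: "taylor_coeff (f + g) = (\<lambda>k. taylor_coeff f k + taylor_coeff g k)"
proof -
  have sums: "(\<lambda>k. (taylor_coeff f k + taylor_coeff g k) $ i * z ^ k) sums ((f + g) z $ i)"
    if "z \<in> unit_disk" for z i
    using sums_add[OF hardy_sums[OF assms(1) that, of i] hardy_sums[OF assms(2) that, of i]]
    by (simp add: ring_distribs)
  have outside: "(f + g) z = 0" if "z \<notin> unit_disk" for z
    using that by (simp add: hardy_outside assms)
  note summable = square_summable_add[OF hardy_summable[OF assms(1)] hardy_summable[OF assms(2)]]
  show "f + g \<in> hardy_space"
    by (rule hardy_spaceI(1)[where f = "f + g", OF sums outside summable])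
  show "taylor_coeff (f + g) = (\<lambda>k. taylor_coeff f k + taylor_coeff g k)"
    by (rule hardy_spaceI(2)[where f = "f + g", OF sums outside summable])
qed

lemma
  fixes f :: "complex \<Rightarrow> complex^'n"
  assumes "f \<in> hardy_space"
  shows hardy_scale: "fscale c f \<in> hardy_space"
    and taylor_coeff_scale: "taylor_coeff (fscale c f) = (\<lambda>k. c *s taylor_coeff f k)"
proof -
  have sums: "(\<lambda>k. (c *s taylor_coeff f k) $ i * z ^ k) sums (fscale c f z $ i)"
    if "z \<in> unit_disk" for z i
    using sums_mult[OF hardy_sums[OF assms(1) that, of i], of c]
    by (simp add: fscale_def mult.assoc)
  have outside: "fscale c f z = 0" if "z \<notin> unit_disk" for z
    using that by (simp add: hardy_outside assms fscale_def)
  note summable = square_summable_scale[OF hardy_summable[OF assms], of c]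
  show "fscale c f \<in> hardy_space"
    by (rule hardy_spaceI(1)[where f = "fscale c f", OF sums outside summable])
  show "taylor_coeff (fscale c f) = (\<lambda>k. c *s taylor_coeff f k)"
    by (rule hardy_spaceI(2)[where f = "fscale c f", OF sums outside summable])
qed

lemma hardy_zero: "0 \<in> hardy_space"
  by (rule hardy_spaceI(1)[of "\<lambda>k. 0"]) auto

lemma taylor_coeff_zero: "taylor_coeff (0 :: complex \<Rightarrow> complex^'n) = (\<lambda>k. 0)"
  by (rule hardy_spaceI(2)) auto

lemma taylor_coeff_diff:
  fixes f g :: "complex \<Rightarrow> complex^'n"
  assumes "f \<in> hardy_space" "g \<in> hardy_space"
  shows "taylor_coeff (f - g) = (\<lambda>k. taylor_coeff f k - taylor_coeff g k)"
proof -
  have "f - g = f + fscale (-1) g" by (simp add: fun_eq_iff fscale_def vec_eq_iff)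
  then have "taylor_coeff (f - g) = (\<lambda>k. taylor_coeff f k + (-1) *s taylor_coeff g k)"
    by (simp only: taylor_coeff_scale[OF assms(2)] taylor_coeff_add[OF assms(1) hardy_scale[OF assms(2)]])
  then show ?thesis by (simp add: fun_eq_iff vec_eq_iff)
qed

lemma summable_cinner:
  assumes "summable (\<lambda>k. (norm (a k))\<^sup>2)" "summable (\<lambda>k. (norm (b k))\<^sup>2)"
  shows "summable (\<lambda>k. cinner (a k) (b k))"
  by (rule summable_comparison_test'[OF summable_add[OF assms]])
    (rule order_trans[OF cinner_bound product_le_squares])

lemma hardy_ip_sums:
  assumes "f \<in> hardy_space" "g \<in> hardy_space"
  shows "(\<lambda>k. cinner (taylor_coeff f k) (taylor_coeff g k)) sums hardy_ip f g"
  unfolding hardy_ip_def by (intro summable_sums summable_cinner hardy_summable assms)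

lemma hardy_norm_sums:
  assumes "f \<in> hardy_space"
  shows "(\<lambda>k. (norm (taylor_coeff f k))\<^sup>2) sums (ip_norm hardy_ip f)\<^sup>2"
    and "hardy_ip f f = of_real ((ip_norm hardy_ip f)\<^sup>2)"
proof -
  let ?s = "\<Sum>k. (norm (taylor_coeff f k))\<^sup>2"
  have s: "(\<lambda>k. (norm (taylor_coeff f k))\<^sup>2) sums ?s"
    using hardy_summable[OF assms] by (rule summable_sums)
  then have "hardy_ip f f = of_real ?s"
    using hardy_ip_sums[OF assms assms] sums_of_real[OF s, where 'a = complex]
    by (simp add: cinner_self sums_unique2)
  moreover from this have "(ip_norm hardy_ip f)\<^sup>2 = ?s"
    using s by (simp add: ip_norm_def suminf_nonneg sums_iff)
  ultimately show "(\<lambda>k. (norm (taylor_coeff f k))\<^sup>2) sums (ip_norm hardy_ip f)\<^sup>2"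
    "hardy_ip f f = of_real ((ip_norm hardy_ip f)\<^sup>2)" using s by simp_all
qed

lemma hardy_ip_self_nonneg:
  assumes "f \<in> hardy_space"
  shows "0 \<le> Re (hardy_ip f f)"
  by (subst hardy_norm_sums(2)[OF assms]) simp

lemma hardy_norm_nonneg: "f \<in> hardy_space \<Longrightarrow> 0 \<le> ip_norm hardy_ip f"
  by (simp add: ip_norm_def hardy_ip_self_nonneg)

lemma sum_taylor_coeff_le:
  assumes "f \<in> hardy_space"
  shows "(\<Sum>k<N. (norm (taylor_coeff f k))\<^sup>2) \<le> (ip_norm hardy_ip f)\<^sup>2"
  using hardy_norm_sums(1)[OF assms] sum_le_suminf[of "\<lambda>k. (norm (taylor_coeff f k))\<^sup>2" "{..<N}"]
  by (simp add: sums_iff)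

text \<open>
  In a Cauchy sequence the coefficients of each degree converge, since they are bounded by the norm.
  The limit sequence is square-summable and is the limit in norm, because every partial sum of
  \<open>\<Sum>\<^sub>k \<bar>a\<^sub>k(n) - a\<^sub>k\<bar>\<^sup>2\<close> is the limit over \<open>m\<close> of those of \<open>\<Sum>\<^sub>k \<bar>a\<^sub>k(n) - a\<^sub>k(m)\<bar>\<^sup>2\<close>.
\<close>

lemma hardy_complete:
  fixes F :: "nat \<Rightarrow> complex \<Rightarrow> complex^'n"
  assumes F: "\<And>n. F n \<in> hardy_space"
    and cauchy: "\<And>e. e > 0 \<Longrightarrow> \<exists>N. \<forall>k\<ge>N. \<forall>l\<ge>N. ip_norm hardy_ip (F k - F l) < e"
  shows "\<exists>f\<in>hardy_space. (\<lambda>k. ip_norm hardy_ip (F k - f)) \<longlonglongrightarrow> 0"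
proof -
  define a where "a n = taylor_coeff (F n)" for n
  have diff: "F n - F m \<in> hardy_space" for n m
    using hardy_add[OF F hardy_scale[OF F, of "-1"], of n m]
    by (simp add: fscale_def plus_fun_def fun_diff_def)
  have a_diff: "taylor_coeff (F n - F m) k = a n k - a m k" for n m k
    by (simp add: taylor_coeff_diff F a_def)
  have "convergent (\<lambda>n. a n k)" for k
    unfolding Cauchy_convergent_iff[symmetric]
  proof (rule CauchyI)
    fix e :: real assume "e > 0"
    from cauchy[OF this] obtain N where N: "\<And>n m. n \<ge> N \<Longrightarrow> m \<ge> N \<Longrightarrow> ip_norm hardy_ip (F n - F m) < e"
      by blast
    have "norm (a n k - a m k) < e" if "n \<ge> N" "m \<ge> N" for n m
    proof -
      have "(norm (a n k - a m k))\<^sup>2 \<le> (\<Sum>j<Suc k. (norm (a n j - a m j))\<^sup>2)"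
        by (rule member_le_sum) auto
      also have "\<dots> \<le> (ip_norm hardy_ip (F n - F m))\<^sup>2"
        using sum_taylor_coeff_le[OF diff, of n m "Suc k"] by (simp only: a_diff)
      finally have "norm (a n k - a m k) \<le> ip_norm hardy_ip (F n - F m)"
        using hardy_norm_nonneg[OF diff] power2_le_imp_le by blast
      then show ?thesis using N[OF that] by simp
    qed
    then show "\<exists>M. \<forall>m\<ge>M. \<forall>n\<ge>M. norm (a m k - a n k) < e" by blast
  qed
  then obtain A where A: "\<And>k. (\<lambda>n. a n k) \<longlonglongrightarrow> A k"
    unfolding convergent_def by metis
  have tail: "\<exists>N. \<forall>n\<ge>N. \<forall>M. (\<Sum>k<M. (norm (a n k - A k))\<^sup>2) \<le> e\<^sup>2" if "e > 0" for e
  proof -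
    from cauchy[OF that] obtain N where N: "\<And>n m. n \<ge> N \<Longrightarrow> m \<ge> N \<Longrightarrow> ip_norm hardy_ip (F n - F m) < e"
      by blast
    have "(\<Sum>k<M. (norm (a n k - A k))\<^sup>2) \<le> e\<^sup>2" if n: "n \<ge> N" for n M
    proof (rule tendsto_upperbound)
      show "(\<lambda>m. \<Sum>k<M. (norm (a n k - a m k))\<^sup>2) \<longlonglongrightarrow> (\<Sum>k<M. (norm (a n k - A k))\<^sup>2)"
        by (intro tendsto_intros A)
      have "(\<Sum>k<M. (norm (a n k - a m k))\<^sup>2) \<le> e\<^sup>2" if "m \<ge> N" for m
      proof -
        have "(ip_norm hardy_ip (F n - F m))\<^sup>2 \<le> e\<^sup>2"
          using hardy_norm_nonneg[OF diff, of n m] N[OF n that] by (intro power_mono) auto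
        then show ?thesis using sum_taylor_coeff_le[OF diff, of n m M] by (simp add: a_diff)
      qed
      then show "eventually (\<lambda>m. (\<Sum>k<M. (norm (a n k - a m k))\<^sup>2) \<le> e\<^sup>2) sequentially"
        unfolding eventually_sequentially by blast
    qed simp
    then show ?thesis by blast
  qed
  obtain N where "\<And>M. (\<Sum>k<M. (norm (a N k - A k))\<^sup>2) \<le> 1"
    using tail[of 1] by auto
  then have "summable (\<lambda>k. (norm (a N k - A k))\<^sup>2)"
    by (intro summableI_nonneg_bounded) auto
  then have "summable (\<lambda>k. (norm ((-1) *s (a N k - A k)))\<^sup>2)"
    by (rule square_summable_scale)
  from square_summable_add[OF hardy_summable[OF F, of N] this]
  have "summable (\<lambda>k. (norm (a N k + (-1) *s (a N k - A k)))\<^sup>2)"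
    by (simp only: a_def)
  moreover have "a N k + (-1) *s (a N k - A k) = A k" for k by (simp add: vec_eq_iff)
  ultimately have "summable (\<lambda>k. (norm (A k))\<^sup>2)" by (simp only:)
  then obtain f where f: "f \<in> hardy_space" "taylor_coeff f = A" by (rule hardy_of_coeffs)
  have Ff: "F n - f \<in> hardy_space" for n
    using hardy_add[OF F hardy_scale[OF f(1), of "-1"], of n]
    by (simp add: fscale_def plus_fun_def fun_diff_def)
  have "(\<lambda>n. ip_norm hardy_ip (F n - f)) \<longlonglongrightarrow> 0"
  proof (rule LIMSEQ_I)
    fix r :: real assume "r > 0"
    then obtain N where N: "\<And>n M. n \<ge> N \<Longrightarrow> (\<Sum>k<M. (norm (a n k - A k))\<^sup>2) \<le> (r/2)\<^sup>2"
      using tail[of "r/2"] by auto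
    have "ip_norm hardy_ip (F n - f) < r" if "n \<ge> N" for n
    proof -
      have "(ip_norm hardy_ip (F n - f))\<^sup>2 \<le> (r/2)\<^sup>2"
        using hardy_norm_sums(1)[OF Ff, of n] suminf_le_const[OF _ N[OF that]]
        by (simp add: sums_iff taylor_coeff_diff F f a_def[symmetric])
      then have "ip_norm hardy_ip (F n - f) \<le> r/2"
        using \<open>r > 0\<close> power2_le_imp_le by (metis half_gt_zero less_imp_le)
      then show ?thesis using \<open>r > 0\<close> by simp
    qed
    then show "\<exists>no. \<forall>n\<ge>no. norm (ip_norm hardy_ip (F n - f) - 0) < r"
      using hardy_norm_nonneg[OF Ff] by (intro exI[of _ N]) simp
  qed
  then show ?thesis using f by blast
qed

interpretation hardy: hilbert_function_space "hardy_space :: (complex \<Rightarrow> complex^'n) set" hardy_ip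
proof
  show "cfun.subspace (hardy_space :: (complex \<Rightarrow> complex^'n) set)"
    unfolding cfun.subspace_def
    by (auto simp: hardy_zero[unfolded zero_fun_def] hardy_zero hardy_add hardy_scale)
next
  fix f g h :: "complex \<Rightarrow> complex^'n" assume *: "f \<in> hardy_space" "g \<in> hardy_space" "h \<in> hardy_space"
  show "hardy_ip (f + g) h = hardy_ip f h + hardy_ip g h"
    using hardy_ip_sums[OF hardy_add[OF *(1,2)] *(3)]
      sums_add[OF hardy_ip_sums[OF *(1,3)] hardy_ip_sums[OF *(2,3)]]
    by (simp add: taylor_coeff_add * cinner_add sums_unique2)
next
  fix c and f g :: "complex \<Rightarrow> complex^'n" assume *: "f \<in> hardy_space" "g \<in> hardy_space"
  show "hardy_ip (fscale c f) g = c * hardy_ip f g"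
    using hardy_ip_sums[OF hardy_scale[OF *(1), of c] *(2)] sums_mult[OF hardy_ip_sums[OF *], of c]
    by (simp add: taylor_coeff_scale * cinner_scale sums_unique2)
next
  fix f g :: "complex \<Rightarrow> complex^'n" assume *: "f \<in> hardy_space" "g \<in> hardy_space"
  show "hardy_ip g f = cnj (hardy_ip f g)"
    using sums_cnj[THEN iffD2, OF hardy_ip_sums[OF *]]
    by (intro sums_unique2[OF hardy_ip_sums[OF *(2,1)]]) (simp only: cinner_commute[symmetric])
next
  fix f :: "complex \<Rightarrow> complex^'n" assume f: "f \<in> hardy_space"
  show "0 \<le> Re (hardy_ip f f)" using f by (rule hardy_ip_self_nonneg)
  assume "hardy_ip f f = 0"
  then have "(\<lambda>k. (norm (taylor_coeff f k))\<^sup>2) sums 0"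
    using hardy_norm_sums[OF f] by simp
  then have "taylor_coeff f = (\<lambda>k. 0)"
    using suminf_eq_zero_iff[of "\<lambda>k. (norm (taylor_coeff f k))\<^sup>2"] by (auto simp: sums_iff)
  then show "f = 0" by (intro hardy_eqI[OF f hardy_zero]) (simp only: taylor_coeff_zero)
qed (rule hardy_complete)

subsection \<open>Szego kernels, monomials and multiplication by the variable\<close>

lemma
  fixes v :: "complex^'n"
  assumes l: "l \<in> unit_disk"
  shows szego_in_hardy: "restr unit_disk (\<lambda>z. szego l z *s v) \<in> hardy_space"
    and taylor_coeff_szego: "taylor_coeff (restr unit_disk (\<lambda>z. szego l z *s v)) = (\<lambda>k. cnj l ^ k *s v)"
proof -
  have "(\<lambda>k. (cnj l ^ k *s v) $ i * z ^ k) sums (restr unit_disk (\<lambda>z. szego l z *s v) z $ i)"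
    if z: "z \<in> unit_disk" for z i
  proof -
    have "cmod (cnj l * z) < 1"
      using l z mult_strict_mono'[of "cmod l" 1 "cmod z" 1] by (simp add: norm_mult)
    from sums_mult2[OF geometric_sums[OF this], of "v $ i"] show ?thesis
      using z by (simp add: restr_def szego_def power_mult_distrib mult_ac)
  qed
  moreover have "summable (\<lambda>k. (norm (cnj l ^ k *s v))\<^sup>2)"
  proof -
    have "summable (\<lambda>k. (norm v)\<^sup>2 * ((cmod l)\<^sup>2) ^ k)"
      using l by (intro summable_mult summable_geometric) (auto simp: abs_square_less_1)
    then show ?thesis
      by (simp add: norm_vector_scale norm_power power_mult_distrib mult.commute power_mult[symmetric])
  qed
  ultimately show "restr unit_disk (\<lambda>z. szego l z *s v) \<in> hardy_space"
    "taylor_coeff (restr unit_disk (\<lambda>z. szego l z *s v)) = (\<lambda>k. cnj l ^ k *s v)"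
    by (intro hardy_spaceI; simp add: restr_def)+
qed

lemma hardy_reproducing:
  fixes f :: "complex \<Rightarrow> complex^'n"
  assumes f: "f \<in> hardy_space" and l: "l \<in> unit_disk"
  shows "hardy_ip f (restr unit_disk (\<lambda>z. szego l z *s v)) = cinner (f l) v"
proof -
  have "(\<lambda>k. \<Sum>i\<in>UNIV. taylor_coeff f k $ i * l ^ k * cnj (v $ i)) sums (\<Sum>i\<in>UNIV. f l $ i * cnj (v $ i))"
    by (intro sums_sum sums_mult2 hardy_sums f l)
  then have "(\<lambda>k. cinner (taylor_coeff f k) (cnj l ^ k *s v)) sums cinner (f l) v"
    by (simp add: cinner_def mult.assoc)
  moreover have "(\<lambda>k. cinner (taylor_coeff f k) (cnj l ^ k *s v)) sums
      hardy_ip f (restr unit_disk (\<lambda>z. szego l z *s v))"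
    using hardy_ip_sums[OF f szego_in_hardy[OF l, of v]] by (simp only: taylor_coeff_szego[OF l])
  ultimately show ?thesis by (rule sums_unique2[symmetric])
qed

lemma
  fixes v :: "complex^'n"
  shows monomial_in_hardy: "restr unit_disk (\<lambda>z. z ^ k *s v) \<in> hardy_space"
    and taylor_coeff_monomial:
      "taylor_coeff (restr unit_disk (\<lambda>z. z ^ k *s v)) = (\<lambda>j. if j = k then v else 0)"
proof -
  have "(\<lambda>j. (if j = k then v else 0) $ i * z ^ j) sums (restr unit_disk (\<lambda>z. z ^ k *s v) z $ i)"
    if z: "z \<in> unit_disk" for z i
  proof -
    have "(\<lambda>j. (if j = k then v else 0) $ i * z ^ j) = (\<lambda>j. if j = k then v $ i * z ^ j else 0)"
      by (auto simp: fun_eq_iff)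
    then show ?thesis using z sums_single[of k "\<lambda>j. v $ i * z ^ j"] by (simp add: restr_def mult.commute)
  qed
  moreover have "summable (\<lambda>j. (norm (if j = k then v else 0))\<^sup>2)"
    by (rule summable_finite[of "{k}"]) auto
  ultimately show "restr unit_disk (\<lambda>z. z ^ k *s v) \<in> hardy_space"
    "taylor_coeff (restr unit_disk (\<lambda>z. z ^ k *s v)) = (\<lambda>j. if j = k then v else 0)"
    by (intro hardy_spaceI; simp add: restr_def)+
qed

lemma taylor_coeff_sum:
  fixes f :: "'i \<Rightarrow> complex \<Rightarrow> complex^'n"
  assumes "\<And>i. i \<in> A \<Longrightarrow> f i \<in> hardy_space"
  shows "taylor_coeff (sum f A) k = (\<Sum>i\<in>A. taylor_coeff (f i) k)"
  using assms
proof (induction A rule: infinite_finite_induct)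
  case (insert x A)
  have "taylor_coeff (sum f (insert x A)) k = taylor_coeff (f x + sum f A) k"
    by (rule arg_cong[where f = "\<lambda>g. taylor_coeff g k", OF sum.insert[OF insert(1,2)]])
  also have "\<dots> = taylor_coeff (f x) k + taylor_coeff (sum f A) k"
    using insert(4) by (subst taylor_coeff_add) (auto intro!: hardy.sum_in)
  also have "\<dots> = (\<Sum>i\<in>insert x A. taylor_coeff (f i) k)" using insert by simp
  finally show ?case .
next
  case (infinite A)
  show ?case unfolding sum.infinite[OF infinite(1)] taylor_coeff_zero ..
next
  case empty
  show ?case unfolding sum.empty taylor_coeff_zero ..
qed

lemma hardy_ip_monomial:
  assumes "f \<in> hardy_space"
  shows "hardy_ip f (restr unit_disk (\<lambda>z. z ^ k *s v)) = cinner (taylor_coeff f k) v"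
proof -
  have "(\<lambda>j. if j = k then cinner (taylor_coeff f j) v else 0) sums cinner (taylor_coeff f k) v"
    by (rule sums_single)
  moreover have "cinner (taylor_coeff f j) (if j = k then v else 0) =
      (if j = k then cinner (taylor_coeff f j) v else 0)" for j by simp
  ultimately show ?thesis
    using hardy_ip_sums[OF assms monomial_in_hardy, of k v]
    by (simp add: taylor_coeff_monomial sums_unique2)
qed

lemma
  fixes f :: "complex \<Rightarrow> complex^'n"
  assumes f: "f \<in> hardy_space"
  shows shift_in_hardy: "fmult (\<lambda>z. z) f \<in> hardy_space"
    and taylor_coeff_shift: "taylor_coeff (fmult (\<lambda>z. z) f) = case_nat 0 (taylor_coeff f)"
proof -
  have "(\<lambda>k. case_nat 0 (taylor_coeff f) k $ i * z ^ k) sums (fmult (\<lambda>z. z) f z $ i)"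
    if z: "z \<in> unit_disk" for z i
  proof (rule sums_Suc_imp)
    show "(\<lambda>k. case_nat 0 (taylor_coeff f) (Suc k) $ i * z ^ Suc k) sums (fmult (\<lambda>z. z) f z $ i)"
      using sums_mult2[OF hardy_sums[OF f z, of i], of z] by (simp add: fmult_def mult_ac)
  qed simp
  moreover have "summable (\<lambda>k. (norm (case_nat 0 (taylor_coeff f) k))\<^sup>2)"
    using hardy_summable[OF f] by (subst summable_Suc_iff[symmetric]) simp
  ultimately show "fmult (\<lambda>z. z) f \<in> hardy_space"
    "taylor_coeff (fmult (\<lambda>z. z) f) = case_nat 0 (taylor_coeff f)"
    using f by (intro hardy_spaceI; simp add: fmult_def hardy_outside)+
qed

lemma hardy_ip_shift:
  assumes "f \<in> hardy_space" "g \<in> hardy_space"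
  shows "hardy_ip (fmult (\<lambda>z. z) f) (fmult (\<lambda>z. z) g) = hardy_ip f g"
proof -
  have "(\<lambda>k. cinner (case_nat 0 (taylor_coeff f) k) (case_nat 0 (taylor_coeff g) k)) sums hardy_ip f g"
    by (rule sums_Suc_imp) (use hardy_ip_sums[OF assms] in simp_all)
  moreover note hardy_ip_sums[OF assms[THEN shift_in_hardy], unfolded assms[THEN taylor_coeff_shift]]
  ultimately show ?thesis by (rule sums_unique2[symmetric])
qed

lemma power_shift_in_hardy:
  assumes "f \<in> hardy_space"
  shows "fmult (\<lambda>z. z ^ j) f \<in> hardy_space \<and> (\<forall>k<j. taylor_coeff (fmult (\<lambda>z. z ^ j) f) k = 0)"
proof (induction j)
  case 0
  then show ?case using assms by (simp add: fmult_def)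
next
  case (Suc j)
  have "fmult (\<lambda>z. z ^ Suc j) f = fmult (\<lambda>z. z) (fmult (\<lambda>z. z ^ j) f)"
    by (simp add: fmult_def fun_eq_iff vec_eq_iff mult.assoc)
  then show ?case
    using Suc shift_in_hardy[of "fmult (\<lambda>z. z ^ j) f"] taylor_coeff_shift[of "fmult (\<lambda>z. z ^ j) f"]
    by (auto split: nat.split)
qed

lemma hardy_zero_if_zero_off_finite:
  fixes f :: "complex \<Rightarrow> complex^'n"
  assumes f: "f \<in> hardy_space" and E: "finite E" and zero: "\<And>l. l \<in> unit_disk - E \<Longrightarrow> f l = 0"
  shows "f = 0"
proof
  fix l
  have "f l $ i = 0" if l: "l \<in> unit_disk" for i
  proof -
    have "(\<lambda>z. f z $ i) holomorphic_on unit_disk" using f by (simp add: hardy_space_def)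
    then have "isCont (\<lambda>z. f z $ i) l"
      using l holomorphic_on_imp_continuous_on continuous_on_eq_continuous_at[OF open_ball] by blast
    then have "(\<lambda>z. f z $ i) \<midarrow>l\<rightarrow> f l $ i" by (simp add: isCont_def)
    moreover have "(\<lambda>z. f z $ i) \<midarrow>l\<rightarrow> 0"
    proof (rule tendsto_eventually)
      have "open (unit_disk - (E - {l}))"
        using E by (intro open_Diff finite_imp_closed) auto
      then have "eventually (\<lambda>z. z \<in> unit_disk - (E - {l}) - {l}) (at l)"
        using l by (intro eventually_at_in_open) auto
      then show "eventually (\<lambda>z. f z $ i = 0) (at l)"
        by eventually_elim (auto simp: zero)
    qed
    ultimately show ?thesis using tendsto_unique by (metis at_neq_bot)
  qed
  then show "f l = 0 l"
    by (cases "l \<in> unit_disk") (auto simp: vec_eq_iff hardy_outside[OF f])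
qed

section \<open>Kernels that factor through the Szego kernel\<close>

text \<open>
  Only one of the two factorizations of an admissible kernel is kept, along one coordinate \<open>c\<close>. The
  two coordinates of the curve give two instances, and the second one supplies multiplication by
  \<open>w\<close>. The last assumption is all that is needed about the geometry of the underlying set.
\<close>

locale szego_factored_rkhs = rkhs V K H ip
  for V :: "'x set" and K :: "'x \<Rightarrow> 'x \<Rightarrow> complex^'a^'a"
    and H :: "('x \<Rightarrow> complex^'a::finite) set" and ip :: "('x, 'a) fun_ip" +
  fixes c :: "'x \<Rightarrow> complex" and Q :: "'x \<Rightarrow> complex^'q^'a"
  assumes coordinate_in_disk: "x \<in> V \<Longrightarrow> c x \<in> unit_disk"
    and kernel_factored: "x \<in> V \<Longrightarrow> y \<in> V \<Longrightarrow>
      K x y = map_matrix (\<lambda>t. t / (1 - c x * cnj (c y))) (Q x ** cadjoint (Q y))"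
    and generic_fibres_separate: "\<exists>E. finite E \<and>
      (\<forall>l \<in> unit_disk - E. \<forall>v. (\<forall>x\<in>V. c x = l \<longrightarrow> Q x *v v = 0) \<longrightarrow> v = 0)"
begin

abbreviation szego_vector :: "'x \<Rightarrow> complex^'a \<Rightarrow> complex \<Rightarrow> complex^'q" where
  "szego_vector y \<gamma> \<equiv> restr unit_disk (\<lambda>t. szego (c y) t *s (cadjoint (Q y) *v \<gamma>))"

definition szego_vectors :: "(complex \<Rightarrow> complex^'q) set" where
  "szego_vectors = {szego_vector y \<gamma> | y \<gamma>. y \<in> V}"

text \<open>
  This is the unitary operator from the Hardy space onto \<open>H\<close> that sends
  \<open>s\<^bsub>c(y)\<^esub> Q(y)\<^sup>* \<gamma>\<close> to the kernel function \<open>K\<^sub>y \<gamma>\<close>. The reproducing properties on both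
  sides force it to be given by this formula.
\<close>

definition transfer :: "(complex \<Rightarrow> complex^'q) \<Rightarrow> 'x \<Rightarrow> complex^'a" where
  "transfer f = restr V (\<lambda>x. Q x *v f (c x))"

lemma szego_vectors_in_hardy: "szego_vectors \<subseteq> hardy_space"
  unfolding szego_vectors_def using szego_in_hardy[OF coordinate_in_disk] by blast

lemma span_szego_in_hardy: "cfun.span szego_vectors \<subseteq> hardy_space"
  by (rule hardy.span_in) (rule szego_vectors_in_hardy)

lemma hardy_ip_szego_vector:
  assumes "f \<in> hardy_space" "y \<in> V"
  shows "hardy_ip f (szego_vector y \<gamma>) = cinner (Q y *v f (c y)) \<gamma>"
  unfolding hardy_reproducing[OF assms(1) coordinate_in_disk[OF assms(2)]] cinner_adjoint ..

text \<open>
  A function orthogonal to all \<open>s\<^sub>\<lambda> Q(x)\<^sup>* \<gamma>\<close> is annihilated by \<open>Q(x)\<close> at the coordinate of every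
  \<open>x\<close>, hence vanishes off a finite set.
\<close>

theorem szego_vectors_dense:
  "dense_in hardy_space hardy_ip (cfun.span szego_vectors)"
proof (rule hardy.dense_if_orthogonal_complement_trivial[OF cfun.subspace_span span_szego_in_hardy])
  fix f :: "complex \<Rightarrow> complex^'q"
  assume f: "f \<in> hardy_space" and orth: "\<And>g. g \<in> cfun.span szego_vectors \<Longrightarrow> hardy_ip f g = 0"
  have "cinner (Q y *v f (c y)) \<gamma> = cinner 0 \<gamma>" if "y \<in> V" for y \<gamma>
    using orth[OF cfun.span_base, of "szego_vector y \<gamma>"] hardy_ip_szego_vector[OF f that] that
    by (auto simp: szego_vectors_def)
  then have zero: "Q y *v f (c y) = 0" if "y \<in> V" for y
    using cinner_eqI that by blast
  obtain E where "finite E"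
    and E: "\<And>l v. l \<in> unit_disk - E \<Longrightarrow> (\<And>x. x \<in> V \<Longrightarrow> c x = l \<Longrightarrow> Q x *v v = 0) \<Longrightarrow> v = 0"
    using generic_fibres_separate by blast
  show "f = 0"
  proof (rule hardy_zero_if_zero_off_finite[OF f \<open>finite E\<close>])
    fix l assume l: "l \<in> unit_disk - E"
    show "f l = 0" by (rule E[OF l]) (use zero in blast)
  qed
qed

lemma transfer_diff: "transfer (f - g) = transfer f - transfer g"
  by (simp add: transfer_def restr_def fun_eq_iff matrix_vector_mult_diff_distrib)

lemma transfer_add: "transfer (f + g) = transfer f + transfer g"
  by (simp add: transfer_def restr_def fun_eq_iff matrix_vector_right_distrib)

lemma transfer_scale: "transfer (fscale a f) = fscale a (transfer f)"
  by (auto simp: transfer_def restr_def fun_eq_iff fscale_def vector_scalar_commute)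

lemma transfer_zero: "transfer 0 = 0"
  by (simp add: transfer_def restr_def fun_eq_iff)

lemma transfer_szego_vector:
  assumes "y \<in> V"
  shows "transfer (szego_vector y \<gamma>) = kernel_fun V K y \<gamma>"
proof
  fix x
  show "transfer (szego_vector y \<gamma>) x = kernel_fun V K y \<gamma> x"
  proof (cases "x \<in> V")
    case True
    have "K x y *v \<gamma> = szego (c y) (c x) *s (Q x *v (cadjoint (Q y) *v \<gamma>))"
      by (simp add: kernel_factored[OF True assms] map_matrix_divide_mult matrix_vector_mul_assoc
          szego_def mult.commute)
    then show ?thesis
      using True coordinate_in_disk[OF True]
      by (simp add: transfer_def kernel_fun_def restr_def vector_scalar_commute)
  qed (simp add: transfer_def kernel_fun_def restr_def)
qed

lemma transfer_span_in:
  assumes "f \<in> cfun.span szego_vectors" shows "transfer f \<in> H"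
proof -
  have "cfun.subspace {f. transfer f \<in> H}"
    by (rule cfun.subspaceI) (simp_all add: transfer_zero zero_in transfer_add add_in transfer_scale scale_in)
  moreover have "szego_vectors \<subseteq> {f. transfer f \<in> H}"
    using kernel_in by (auto simp: szego_vectors_def transfer_szego_vector)
  ultimately have "cfun.span szego_vectors \<subseteq> {f. transfer f \<in> H}"
    by (intro cfun.span_minimal)
  then show ?thesis using assms by auto
qed

text \<open>When \<open>g\<close> is a Szego vector, both sides pair \<open>Q(y) f(c(y))\<close> with \<open>\<gamma>\<close>.\<close>

lemma ip_transfer_span:
  assumes f: "f \<in> hardy_space" "transfer f \<in> H" and g: "g \<in> cfun.span szego_vectors"
  shows "ip (transfer f) (transfer g) = hardy_ip f g"
proof -
  let ?S = "{g \<in> hardy_space. transfer g \<in> H \<and> ip (transfer f) (transfer g) = hardy_ip f g}"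
  have "cfun.subspace ?S"
  proof (rule cfun.subspaceI)
    show "0 \<in> ?S"
      using hardy_zero zero_in ip_zero_right[OF f(2)] hardy.ip_zero_right[OF f(1)] by (simp add: transfer_zero)
  next
    fix g h assume "g \<in> ?S" "h \<in> ?S"
    then show "g + h \<in> ?S"
      using hardy_add[of g h] add_in[of "transfer g" "transfer h"]
        ip_add_right[OF _ _ f(2), of "transfer g" "transfer h"] hardy.ip_add_right[OF _ _ f(1), of g h]
      by (simp add: transfer_add)
  next
    fix a g assume "g \<in> ?S"
    then show "fscale a g \<in> ?S"
      using hardy_scale[of g a] scale_in[of "transfer g" a]
        ip_scale_right[OF _ f(2), of "transfer g" a] hardy.ip_scale_right[OF _ f(1), of g a]
      by (simp add: transfer_scale)
  qed
  moreover have "szego_vectors \<subseteq> ?S"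
  proof
    fix g assume "g \<in> szego_vectors"
    then obtain y \<gamma> where g: "g = szego_vector y \<gamma>" and y: "y \<in> V" by (auto simp: szego_vectors_def)
    have "ip (transfer f) (transfer g) = cinner (transfer f y) \<gamma>"
      unfolding g transfer_szego_vector[OF y] by (rule reproducing[OF f(2) y])
    also have "\<dots> = hardy_ip f g"
      unfolding g hardy_ip_szego_vector[OF f(1) y] using y by (simp add: transfer_def restr_def)
    finally show "g \<in> ?S"
      using kernel_in[OF y, of \<gamma>] szego_in_hardy[OF coordinate_in_disk[OF y]]
      by (simp add: g transfer_szego_vector[OF y])
  qed
  ultimately have "cfun.span szego_vectors \<subseteq> ?S" by (intro cfun.span_minimal)
  then show ?thesis using g by auto
qed

lemma norm_transfer_span:
  assumes "f \<in> cfun.span szego_vectors"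
  shows "ip_norm ip (transfer f) = ip_norm hardy_ip f"
  unfolding ip_norm_def
  using ip_transfer_span[OF _ transfer_span_in[OF assms] assms] span_szego_in_hardy assms by auto

text \<open>
  Approximate \<open>f\<close> by elements of the span of the Szego vectors. Their images form a Cauchy sequence,
  and evaluation at points, continuous on both sides, identifies its limit with \<open>transfer f\<close>.
\<close>

lemma transfer_approximation:
  assumes f: "f \<in> hardy_space"
  obtains D where "transfer f \<in> H" "\<And>k. D k \<in> cfun.span szego_vectors"
    "(\<lambda>k. ip_norm hardy_ip (D k - f)) \<longlonglongrightarrow> 0"
    "(\<lambda>k. ip_norm ip (transfer (D k) - transfer f)) \<longlonglongrightarrow> 0"
proof -
  have "\<exists>g \<in> cfun.span szego_vectors. ip_norm hardy_ip (f - g) < inverse (real (Suc k))" for k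
    using szego_vectors_dense f unfolding dense_in_def by simp
  then obtain D where D: "\<And>k. D k \<in> cfun.span szego_vectors"
    "\<And>k. ip_norm hardy_ip (f - D k) < inverse (real (Suc k))" by metis
  have DH: "D k \<in> hardy_space" for k using D(1) span_szego_in_hardy by blast
  have close: "ip_norm hardy_ip (D k - f) < inverse (real (Suc k))" for k
    using D(2)[of k] hardy.norm_minus_commute[OF f DH[of k]] by simp
  have lim: "(\<lambda>k. ip_norm hardy_ip (D k - f)) \<longlonglongrightarrow> 0"
  proof (rule tendsto_sandwich[OF _ _ tendsto_const LIMSEQ_inverse_real_of_nat])
    show "eventually (\<lambda>k. 0 \<le> ip_norm hardy_ip (D k - f)) sequentially"
      using hardy.norm_nonneg[OF hardy.diff_in[OF DH f]] by simp
    show "eventually (\<lambda>k. ip_norm hardy_ip (D k - f) \<le> inverse (real (Suc k))) sequentially"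
      using close less_imp_le by (intro always_eventually) blast
  qed
  have TD: "transfer (D k) \<in> H" for k using transfer_span_in[OF D(1)] .
  have "\<exists>N. \<forall>k\<ge>N. \<forall>l\<ge>N. ip_norm ip (transfer (D k) - transfer (D l)) < r" if "r > 0" for r
  proof -
    have "eventually (\<lambda>k. ip_norm hardy_ip (D k - f) < r / 2) sequentially"
      using order_tendstoD(2)[OF lim, of "r / 2"] that by simp
    then obtain N where N: "\<And>k. k \<ge> N \<Longrightarrow> ip_norm hardy_ip (D k - f) < r / 2"
      unfolding eventually_sequentially by blast
    have "ip_norm ip (transfer (D k) - transfer (D l)) < r" if "k \<ge> N" "l \<ge> N" for k l
    proof -
      have "ip_norm ip (transfer (D k) - transfer (D l)) = ip_norm hardy_ip (D k - D l)"
        unfolding transfer_diff[symmetric]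
        by (intro norm_transfer_span cfun.span_diff D(1))
      also have "\<dots> \<le> ip_norm hardy_ip (D k - f) + ip_norm hardy_ip (f - D l)"
        by (rule hardy.norm_diff_triangle[OF DH f DH])
      also have "\<dots> < r"
        using N[OF that(1)] N[OF that(2)] hardy.norm_minus_commute[OF f DH[of l]] by linarith
      finally show ?thesis .
    qed
    then show ?thesis by blast
  qed
  from complete[OF TD this] obtain h where h: "h \<in> H"
    and lim_h: "(\<lambda>k. ip_norm ip (transfer (D k) - h)) \<longlonglongrightarrow> 0" by blast
  have "transfer f = h"
  proof
    fix x
    show "transfer f x = h x"
    proof (cases "x \<in> V")
      case True
      have "cinner (h x) \<gamma> = cinner (transfer f x) \<gamma>" for \<gamma>
      proof (rule LIMSEQ_unique)
        show "(\<lambda>k. ip (transfer (D k)) (kernel_fun V K x \<gamma>)) \<longlonglongrightarrow> cinner (h x) \<gamma>"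
          using ip_tendsto[OF TD h kernel_in[OF True] lim_h] reproducing[OF h True] by simp
        have "(\<lambda>k. hardy_ip (D k) (szego_vector x \<gamma>)) \<longlonglongrightarrow> hardy_ip f (szego_vector x \<gamma>)"
          by (rule hardy.ip_tendsto[OF DH f szego_in_hardy[OF coordinate_in_disk[OF True]] lim])
        then show "(\<lambda>k. ip (transfer (D k)) (kernel_fun V K x \<gamma>)) \<longlonglongrightarrow> cinner (transfer f x) \<gamma>"
          using True unfolding hardy_ip_szego_vector[OF DH True] hardy_ip_szego_vector[OF f True]
            reproducing[OF TD True]
          by (simp add: transfer_def restr_def)
      qed
      then show ?thesis using cinner_eqI by metis
    next
      case False
      then show ?thesis using vanishes_outside[OF h] by (simp add: transfer_def restr_def)
    qed
  qed
  then show ?thesis using that[of D] h D(1) lim lim_h by simp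
qed

lemma transfer_in: "f \<in> hardy_space \<Longrightarrow> transfer f \<in> H"
  using transfer_approximation by blast

lemma ip_transfer:
  assumes f: "f \<in> hardy_space" and g: "g \<in> hardy_space"
  shows "ip (transfer f) (transfer g) = hardy_ip f g"
proof -
  obtain D where D: "\<And>k. D k \<in> cfun.span szego_vectors"
    and lim: "(\<lambda>k. ip_norm hardy_ip (D k - f)) \<longlonglongrightarrow> 0"
      "(\<lambda>k. ip_norm ip (transfer (D k) - transfer f)) \<longlonglongrightarrow> 0"
    using transfer_approximation[OF f] by blast
  have DH: "D k \<in> hardy_space" for k using D span_szego_in_hardy by blast
  have "ip (transfer (D k)) (transfer g) = hardy_ip (D k) g" for k
    using ip_transfer_span[OF g transfer_in[OF g] D, of k] ip_commute[OF transfer_in[OF g] transfer_in[OF DH], of k]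
      hardy.ip_commute[OF g DH, of k] by simp
  then have "(\<lambda>k. hardy_ip (D k) g) \<longlonglongrightarrow> ip (transfer f) (transfer g)"
    using ip_tendsto[OF transfer_in[OF DH] transfer_in[OF f] transfer_in[OF g] lim(2)] by simp
  moreover have "(\<lambda>k. hardy_ip (D k) g) \<longlonglongrightarrow> hardy_ip f g"
    by (rule hardy.ip_tendsto[OF DH f g lim(1)])
  ultimately show ?thesis by (rule LIMSEQ_unique)
qed

lemma norm_transfer: "f \<in> hardy_space \<Longrightarrow> ip_norm ip (transfer f) = ip_norm hardy_ip f"
  by (simp add: ip_norm_def ip_transfer)

lemma transfer_inj:
  assumes f: "f \<in> hardy_space" and g: "g \<in> hardy_space" and eq: "transfer f = transfer g"
  shows "f = g"
proof -
  have "ip_norm hardy_ip (f - g) = ip_norm ip 0"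
    using norm_transfer[OF hardy.diff_in[OF f g]] by (simp add: transfer_diff eq)
  then have "f - g = 0"
    using hardy.norm_eq_0_iff[OF hardy.diff_in[OF f g]] norm_eq_0_iff[OF zero_in] by simp
  then show ?thesis by simp
qed

text \<open>
  The range is complete, being isometric to the Hardy space, and contains all kernel functions,
  whose orthogonal complement is trivial.
\<close>

lemma transfer_surj:
  assumes "h \<in> H"
  obtains f where "f \<in> hardy_space" "h = transfer f"
proof -
  let ?R = "transfer ` hardy_space"
  have sub: "cfun.subspace ?R"
  proof (rule cfun.subspaceI)
    show "0 \<in> ?R" by (rule image_eqI[where f = transfer, OF transfer_zero[symmetric] hardy_zero])
  next
    fix f g assume "f \<in> ?R" "g \<in> ?R"
    then obtain f' g' where fg: "f' \<in> hardy_space" "f = transfer f'" "g' \<in> hardy_space" "g = transfer g'"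
      by blast
    then have "f + g = transfer (f' + g')" by (simp only: transfer_add)
    then show "f + g \<in> ?R" by (rule image_eqI[where f = transfer, OF _ hardy_add[OF fg(1,3)]])
  next
    fix a f assume "f \<in> ?R"
    then obtain f' where f: "f' \<in> hardy_space" "f = transfer f'" by blast
    then have "fscale a f = transfer (fscale a f')" by (simp only: transfer_scale)
    then show "fscale a f \<in> ?R" by (rule image_eqI[where f = transfer, OF _ hardy_scale[OF f(1)]])
  qed
  have "dense_in H ip ?R"
  proof (rule dense_if_orthogonal_complement_trivial[OF sub])
    show "?R \<subseteq> H" using transfer_in by blast
    fix f assume f: "f \<in> H" and orth: "\<And>g. g \<in> ?R \<Longrightarrow> ip f g = 0"
    have "f x = 0" if "x \<in> V" for x
    proof (rule cinner_eqI)
      fix \<gamma>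
      have "kernel_fun V K x \<gamma> \<in> ?R"
        using transfer_szego_vector[OF that, of \<gamma>, symmetric] szego_in_hardy[OF coordinate_in_disk[OF that]]
        by blast
      then show "cinner (f x) \<gamma> = cinner 0 \<gamma>"
        using orth reproducing[OF f that, of \<gamma>] by simp
    qed
    then show "f = 0" using vanishes_outside[OF f] by (auto simp: fun_eq_iff)
  qed
  then have "\<exists>f\<in>hardy_space. ip_norm ip (h - transfer f) < inverse (real (Suc k))" for k
    using assms unfolding dense_in_def by simp
  then obtain F where F: "\<And>k. F k \<in> hardy_space"
    "\<And>k. ip_norm ip (h - transfer (F k)) < inverse (real (Suc k))" by metis
  have TF: "transfer (F k) \<in> H" for k using transfer_in[OF F(1)] .
  have lim: "(\<lambda>k. ip_norm ip (transfer (F k) - h)) \<longlonglongrightarrow> 0"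
  proof (rule tendsto_sandwich[OF _ _ tendsto_const LIMSEQ_inverse_real_of_nat])
    show "eventually (\<lambda>k. 0 \<le> ip_norm ip (transfer (F k) - h)) sequentially"
      using norm_nonneg[OF diff_in[OF TF assms]] by simp
    show "eventually (\<lambda>k. ip_norm ip (transfer (F k) - h) \<le> inverse (real (Suc k))) sequentially"
      by (intro always_eventually allI less_imp_le) (simp only: norm_minus_commute[OF TF assms] F(2))
  qed
  have "\<exists>N. \<forall>k\<ge>N. \<forall>l\<ge>N. ip_norm hardy_ip (F k - F l) < r" if "r > 0" for r
  proof -
    have "eventually (\<lambda>k. ip_norm ip (transfer (F k) - h) < r / 2) sequentially"
      using order_tendstoD(2)[OF lim, of "r / 2"] that by simp
    then obtain N where N: "\<And>k. k \<ge> N \<Longrightarrow> ip_norm ip (transfer (F k) - h) < r / 2"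
      unfolding eventually_sequentially by blast
    have "ip_norm hardy_ip (F k - F l) < r" if "k \<ge> N" "l \<ge> N" for k l
    proof -
      have "ip_norm hardy_ip (F k - F l) = ip_norm ip (transfer (F k) - transfer (F l))"
        unfolding transfer_diff[symmetric]
        by (rule norm_transfer[OF hardy.diff_in[OF F(1) F(1)], symmetric])
      also have "\<dots> \<le> ip_norm ip (transfer (F k) - h) + ip_norm ip (h - transfer (F l))"
        by (rule norm_diff_triangle[OF TF assms TF])
      also have "\<dots> < r"
        using N[OF that(1)] N[OF that(2)] norm_minus_commute[OF assms TF[of l]] by linarith
      finally show ?thesis .
    qed
    then show ?thesis by blast
  qed
  from hardy_complete[OF F(1) this] obtain f where f: "f \<in> hardy_space"
    and lim_f: "(\<lambda>k. ip_norm hardy_ip (F k - f)) \<longlonglongrightarrow> 0" by blast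
  have lim_f': "(\<lambda>k. ip_norm ip (transfer (F k) - transfer f)) \<longlonglongrightarrow> 0"
    using lim_f unfolding transfer_diff[symmetric] norm_transfer[OF hardy.diff_in[OF F(1) f]] .
  have "h = transfer f"
  proof -
    have d: "h - transfer f \<in> H" by (intro diff_in assms transfer_in f)
    have "ip h (h - transfer f) = ip (transfer f) (h - transfer f)"
      by (rule LIMSEQ_unique[OF ip_tendsto[OF TF assms d lim] ip_tendsto[OF TF transfer_in[OF f] d lim_f']])
    then have "ip (h - transfer f) (h - transfer f) = 0"
      using ip_diff[OF assms transfer_in[OF f] d] by simp
    then have "h - transfer f = 0" using ip_definite[OF d] by blast
    then show ?thesis by simp
  qed
  with f show ?thesis by (rule that)
qed

lemma column_monomial_eq_transfer:
  "restr V (\<lambda>x. c x ^ k *s column j (Q x)) = transfer (restr unit_disk (\<lambda>t. t ^ k *s axis j 1))"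
proof
  fix x
  show "restr V (\<lambda>x. c x ^ k *s column j (Q x)) x = transfer (restr unit_disk (\<lambda>t. t ^ k *s axis j 1)) x"
    using coordinate_in_disk[of x]
    by (simp add: transfer_def restr_def vector_scalar_commute matrix_vector_mult_axis)
qed

text \<open>
  The basis is the image of the standard basis \<open>t\<^sup>k e\<^sub>j\<close> of the Hardy space.
\<close>

theorem column_monomials_orthonormal_basis:
  "orthonormal_basis H ip (\<lambda>(k, j). restr V (\<lambda>x. c x ^ k *s column j (Q x)))" (is "orthonormal_basis H ip ?b")
  unfolding orthonormal_basis_def
proof (intro conjI allI)
  let ?m = "\<lambda>k j. restr unit_disk (\<lambda>t. t ^ k *s (axis j 1 :: complex^'q))"
  have b: "?b (k, j) = transfer (?m k j)" for k j by (simp add: column_monomial_eq_transfer)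
  show range: "range ?b \<subseteq> H" using b transfer_in[OF monomial_in_hardy] by auto
  show "ip (?b i) (?b j) = (if i = j then 1 else 0)" for i j
    by (cases i; cases j)
      (simp add: column_monomial_eq_transfer ip_transfer monomial_in_hardy hardy_ip_monomial
        taylor_coeff_monomial, simp add: axis_def)
  show "dense_in H ip (cfun.span (range ?b))"
  proof (rule dense_if_orthogonal_complement_trivial[OF cfun.subspace_span span_in[OF range]])
    fix h assume h: "h \<in> H" and orth: "\<And>g. g \<in> cfun.span (range ?b) \<Longrightarrow> ip h g = 0"
    obtain f where f: "f \<in> hardy_space" "h = transfer f" using transfer_surj[OF h] .
    have "taylor_coeff f k $ j = 0" for k j
      using orth[OF cfun.span_base[OF rangeI], of "(k, j)"] f
      by (simp add: column_monomial_eq_transfer ip_transfer monomial_in_hardy hardy_ip_monomial)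
    then have "taylor_coeff f = taylor_coeff 0"
      unfolding taylor_coeff_zero by (simp add: fun_eq_iff vec_eq_iff)
    then have "f = 0" using hardy_eqI[OF f(1) hardy_zero] by blast
    then show "h = 0" using f transfer_zero by simp
  qed
qed

lemma coordinate_mult_transfer: "fmult c (transfer f) = transfer (fmult (\<lambda>t. t) f)"
  by (auto simp: fmult_def transfer_def restr_def fun_eq_iff vector_scalar_commute)

lemma coordinate_mult_in: "h \<in> H \<Longrightarrow> fmult c h \<in> H"
  by (elim transfer_surj) (simp add: coordinate_mult_transfer transfer_in shift_in_hardy)

lemma norm_coordinate_mult: "h \<in> H \<Longrightarrow> ip_norm ip (fmult c h) = ip_norm ip h"
  by (elim transfer_surj)
    (simp add: coordinate_mult_transfer ip_transfer ip_norm_def shift_in_hardy hardy_ip_shift)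

lemma coordinate_mult_power: "(fmult c ^^ j) (transfer f) = transfer (fmult (\<lambda>t. t ^ j) f)"
proof (induction j)
  case 0
  then show ?case by (simp add: fmult_def)
next
  case (Suc j)
  have "fmult (\<lambda>t. t ^ Suc j) f = fmult (\<lambda>t. t) (fmult (\<lambda>t. t ^ j) f)"
    by (simp add: fmult_def fun_eq_iff vec_eq_iff mult.assoc)
  then show ?case using Suc by (simp add: coordinate_mult_transfer)
qed

text \<open>
  Under the unitary this is the shift of the Hardy space, and the coefficients of degree below \<open>j\<close>
  of \<open>t\<^sup>j f\<close> vanish.
\<close>

theorem coordinate_mult_pure_isometry: "pure_isometry_on H ip (fmult c)"
  unfolding pure_isometry_on_def isometry_on_def
proof (intro conjI ballI)
  show "fmult c ` H \<subseteq> H" using coordinate_mult_in by blast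
  show "linear_on H (fmult c)"
    by (simp add: linear_on_def fmult_def fscale_def fun_eq_iff vec_eq_iff algebra_simps)
  show "ip_norm ip (fmult c f) = ip_norm ip f" if "f \<in> H" for f
    using norm_coordinate_mult[OF that] .
  show "(\<Inter>j\<in>{1..}. (fmult c ^^ j) ` H) = {0}"
  proof (intro equalityI subsetI)
    fix h assume h: "h \<in> (\<Inter>j\<in>{1..}. (fmult c ^^ j) ` H)"
    have image: "\<exists>g\<in>hardy_space. h = transfer (fmult (\<lambda>t. t ^ Suc j) g)" for j
    proof -
      have "h \<in> (fmult c ^^ Suc j) ` H" by (rule INT_D[OF h]) simp
      then obtain h' where h': "h' \<in> H" "h = (fmult c ^^ Suc j) h'" by (rule imageE)
      obtain g where "g \<in> hardy_space" "h' = transfer g" using transfer_surj[OF h'(1)] .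
      then show ?thesis using h'(2) coordinate_mult_power[of "Suc j" g] by (intro bexI[of _ g]) simp_all
    qed
    obtain f where f: "f \<in> hardy_space" "h = transfer f"
      using image[of 0] power_shift_in_hardy by blast
    have "taylor_coeff f j = 0" for j
    proof -
      obtain g where g: "g \<in> hardy_space" "h = transfer (fmult (\<lambda>t. t ^ Suc j) g)" using image by blast
      note shift = power_shift_in_hardy[OF g(1), of "Suc j"]
      have "f = fmult (\<lambda>t. t ^ Suc j) g"
        by (rule transfer_inj[OF f(1)]) (use shift f g in auto)
      then show ?thesis using shift by simp
    qed
    then have "taylor_coeff f = taylor_coeff 0"
      unfolding taylor_coeff_zero by (simp add: fun_eq_iff)
    then have "f = 0" using hardy_eqI[OF f(1) hardy_zero] by blast
    then show "h \<in> {0}" using f transfer_zero by simp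
  next
    fix h :: "'x \<Rightarrow> complex^'a" assume "h \<in> {0}"
    moreover have "fmult (\<lambda>t. t ^ j) 0 = (0 :: complex \<Rightarrow> complex^'q)" for j
      by (rule ext) (simp add: fmult_def)
    then have "(fmult c ^^ j) 0 = (0 :: 'x \<Rightarrow> complex^'a)" for j
      using coordinate_mult_power[of j 0] by (simp only: transfer_zero)
    ultimately show "h \<in> (\<Inter>j\<in>{1..}. (fmult c ^^ j) ` H)" using zero_in by (auto simp: image_iff)
  qed
qed

text \<open>
  The values of the adjoint \<open>X\<close> of multiplication by \<open>c\<close> are forced by the reproducing property:
  \<open>\<langle>(X f)(x), e\<^sub>i\<rangle> = \<langle>X f, K\<^sub>x e\<^sub>i\<rangle> = \<langle>f, c K\<^sub>x e\<^sub>i\<rangle>\<close>.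
\<close>

definition coordinate_adjoint :: "('x \<Rightarrow> complex^'a) \<Rightarrow> 'x \<Rightarrow> complex^'a" where
  "coordinate_adjoint f = restr V (\<lambda>x. \<chi> i. ip f (fmult c (kernel_fun V K x (axis i 1))))"

lemma coordinate_adjoint_linear: "linear_on H coordinate_adjoint"
proof -
  have "ip (f + g) (fmult c (kernel_fun V K x (axis i 1))) =
      ip f (fmult c (kernel_fun V K x (axis i 1))) + ip g (fmult c (kernel_fun V K x (axis i 1)))"
    if "f \<in> H" "g \<in> H" "x \<in> V" for f g x i
    by (rule ip_add[OF that(1,2) coordinate_mult_in[OF kernel_in[OF that(3)]]])
  moreover have "ip (fscale a f) (fmult c (kernel_fun V K x (axis i 1))) =
      a * ip f (fmult c (kernel_fun V K x (axis i 1)))"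
    if "f \<in> H" "x \<in> V" for a f x i
    by (rule ip_scale[OF that(1) coordinate_mult_in[OF kernel_in[OF that(2)]]])
  ultimately show ?thesis
    by (auto simp: linear_on_def coordinate_adjoint_def restr_def fun_eq_iff fscale_def vec_eq_iff)
qed

lemma coordinate_adjoint_kernel:
  assumes y: "y \<in> V"
  shows "coordinate_adjoint (kernel_fun V K y \<gamma>) = fscale (cnj (c y)) (kernel_fun V K y \<gamma>)"
proof
  fix x
  show "coordinate_adjoint (kernel_fun V K y \<gamma>) x = fscale (cnj (c y)) (kernel_fun V K y \<gamma>) x"
  proof (cases "x \<in> V")
    case x: True
    have "ip (kernel_fun V K y \<gamma>) (fmult c (kernel_fun V K x (axis i 1))) =
        cnj (c y) * (kernel_fun V K y \<gamma> x $ i)" for i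
    proof -
      let ?k = "kernel_fun V K x (axis i 1)"
      have "ip (kernel_fun V K y \<gamma>) (fmult c ?k) = cnj (cinner (fmult c ?k y) \<gamma>)"
        using ip_commute[OF coordinate_mult_in[OF kernel_in[OF x]] kernel_in[OF y]]
          reproducing[OF coordinate_mult_in[OF kernel_in[OF x]] y] by simp
      also have "\<dots> = cnj (c y) * cnj (cinner (?k y) \<gamma>)"
        by (simp add: fmult_def cinner_scale)
      also have "cnj (cinner (?k y) \<gamma>) = ip (kernel_fun V K y \<gamma>) ?k"
        using ip_commute[OF kernel_in[OF x] kernel_in[OF y]] reproducing[OF kernel_in[OF x] y] by simp
      also have "\<dots> = kernel_fun V K y \<gamma> x $ i"
        using reproducing[OF kernel_in[OF y] x] by simp
      finally show ?thesis .
    qed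
    then show ?thesis using x by (simp add: coordinate_adjoint_def restr_def fscale_def vec_eq_iff)
  qed (simp add: coordinate_adjoint_def restr_def kernel_fun_def fscale_def)
qed

abbreviation kernel_funs :: "('x \<Rightarrow> complex^'a) set" where
  "kernel_funs \<equiv> {kernel_fun V K y \<gamma> | y \<gamma>. y \<in> V}"

lemma kernel_span_in: "cfun.span kernel_funs \<subseteq> H"
  by (rule span_in) (use kernel_in in blast)

lemma coordinate_adjoint_in_span:
  assumes "f \<in> cfun.span kernel_funs"
  shows "coordinate_adjoint f \<in> cfun.span kernel_funs"
proof -
  let ?S = "{f \<in> H. coordinate_adjoint f \<in> cfun.span kernel_funs}"
  note add = coordinate_adjoint_linear[unfolded linear_on_def, THEN conjunct1, rule_format]
  note scale = coordinate_adjoint_linear[unfolded linear_on_def, THEN conjunct2, rule_format]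
  have "cfun.subspace ?S"
  proof (rule cfun.subspaceI)
    have "coordinate_adjoint 0 = 0"
      using scale[OF zero_in, of 0] by (simp only: cfun.scale_zero_left)
    then show "0 \<in> ?S" using zero_in cfun.span_zero by simp
  next
    fix f g assume "f \<in> ?S" "g \<in> ?S"
    then show "f + g \<in> ?S" using add_in[of f g] add[of f g] cfun.span_add by auto
  next
    fix a f assume "f \<in> ?S"
    then show "fscale a f \<in> ?S" using scale_in[of f a] scale[of f a] cfun.span_scale by auto
  qed
  moreover have "kernel_funs \<subseteq> ?S"
  proof
    fix f assume f: "f \<in> kernel_funs"
    then obtain y \<gamma> where y: "y \<in> V" "f = kernel_fun V K y \<gamma>" by blast
    then have "coordinate_adjoint f = fscale (cnj (c y)) f" by (simp only: coordinate_adjoint_kernel)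
    also have "\<dots> \<in> cfun.span kernel_funs" by (rule cfun.span_scale[OF cfun.span_base[OF f]])
    finally show "f \<in> ?S" using kernel_in[OF y(1), of \<gamma>] y(2) by blast
  qed
  ultimately have "cfun.span kernel_funs \<subseteq> ?S" by (intro cfun.span_minimal)
  then show ?thesis using assms by auto
qed

lemma coordinate_adjoint_adjoint:
  assumes f: "f \<in> cfun.span kernel_funs" and g: "g \<in> cfun.span kernel_funs"
  shows "ip (coordinate_adjoint f) g = ip f (fmult c g)"
proof -
  have fH: "f \<in> H" and XfH: "coordinate_adjoint f \<in> H"
    using f coordinate_adjoint_in_span[OF f] kernel_span_in by auto
  let ?S = "{g \<in> H. ip (coordinate_adjoint f) g = ip f (fmult c g)}"
  have "cfun.subspace ?S"
  proof (rule cfun.subspaceI)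
    have "fmult c 0 = (0 :: 'x \<Rightarrow> complex^'a)" by (simp add: fmult_def fun_eq_iff)
    then show "0 \<in> ?S" using zero_in ip_zero_right fH XfH by simp
  next
    fix g h assume gh: "g \<in> ?S" "h \<in> ?S"
    have "fmult c (g + h) = fmult c g + fmult c h" by (simp add: fmult_def fun_eq_iff vec_eq_iff algebra_simps)
    then show "g + h \<in> ?S"
      using gh add_in[of g h] ip_add_right[OF _ _ XfH, of g h]
        ip_add_right[OF coordinate_mult_in coordinate_mult_in fH, of g h] by simp
  next
    fix a g assume g: "g \<in> ?S"
    have "fmult c (fscale a g) = fscale a (fmult c g)"
      by (simp add: fmult_def fscale_def fun_eq_iff vec_eq_iff)
    then show "fscale a g \<in> ?S"
      using g scale_in[of g a] ip_scale_right[OF _ XfH, of g a]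
        ip_scale_right[OF coordinate_mult_in fH, of g a] by simp
  qed
  moreover have "kernel_funs \<subseteq> ?S"
  proof
    fix g assume "g \<in> kernel_funs"
    then obtain y \<gamma> where y: "y \<in> V" and g: "g = kernel_fun V K y \<gamma>" by blast
    have gH: "g \<in> H" using kernel_in[OF y] g by simp
    have g_sum: "fmult c g = (\<Sum>i\<in>UNIV. fscale (\<gamma> $ i) (fmult c (kernel_fun V K y (axis i 1))))"
    proof
      fix x
      have "K x y *v \<gamma> = (\<Sum>i\<in>UNIV. \<gamma> $ i *s (K x y *v axis i 1))"
        by (simp add: matrix_mult_sum[of _ \<gamma>] matrix_vector_mult_axis)
      then show "fmult c g x = (\<Sum>i\<in>UNIV. fscale (\<gamma> $ i) (fmult c (kernel_fun V K y (axis i 1)))) x"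
        by (simp add: g fmult_def fscale_def kernel_fun_def restr_def sum_fun_apply vec.scale_sum_right
            vector_smult_assoc mult.commute)
    qed
    have "ip (coordinate_adjoint f) g = cinner (coordinate_adjoint f y) \<gamma>"
      unfolding g by (rule reproducing[OF XfH y])
    also have "\<dots> = (\<Sum>i\<in>UNIV. ip f (fscale (\<gamma> $ i) (fmult c (kernel_fun V K y (axis i 1)))))"
      using y ip_scale_right[OF coordinate_mult_in[OF kernel_in[OF y]] fH]
      by (simp add: cinner_def coordinate_adjoint_def restr_def mult.commute)
    also have "\<dots> = ip f (fmult c g)"
      unfolding g_sum
      by (intro ip_sum_right[symmetric] fH scale_in coordinate_mult_in kernel_in y)
    finally show "g \<in> ?S" using gH by simp
  qed
  ultimately have "cfun.span kernel_funs \<subseteq> ?S" by (intro cfun.span_minimal)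
  then show ?thesis using g by auto
qed

text \<open>
  The adjoint of an isometry is a contraction, so the bound is \<open>1\<close>.
\<close>

theorem kernel_scaling_bounded:
  "\<exists>X. linear_on (cfun.span kernel_funs) X \<and>
    (\<forall>y \<gamma>. y \<in> V \<longrightarrow> X (kernel_fun V K y \<gamma>) = fscale (cnj (c y)) (kernel_fun V K y \<gamma>)) \<and>
    bounded_on (cfun.span kernel_funs) ip X"
proof (intro exI conjI allI impI)
  show "linear_on (cfun.span kernel_funs) coordinate_adjoint"
    using coordinate_adjoint_linear kernel_span_in unfolding linear_on_def by blast
  show "coordinate_adjoint (kernel_fun V K y \<gamma>) = fscale (cnj (c y)) (kernel_fun V K y \<gamma>)"
    if "y \<in> V" for y \<gamma> by (rule coordinate_adjoint_kernel[OF that])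
  have "ip_norm ip (coordinate_adjoint f) \<le> 1 * ip_norm ip f" if f: "f \<in> cfun.span kernel_funs" for f
  proof -
    let ?X = "coordinate_adjoint f"
    have X: "?X \<in> cfun.span kernel_funs" "?X \<in> H" and fH: "f \<in> H"
      using f coordinate_adjoint_in_span[OF f] kernel_span_in by auto
    have "of_real ((ip_norm ip ?X)\<^sup>2) = ip f (fmult c ?X)"
      unfolding ip_self[OF X(2), symmetric] by (rule coordinate_adjoint_adjoint[OF f X(1)])
    then have "(ip_norm ip ?X)\<^sup>2 = cmod (ip f (fmult c ?X))"
      by (metis norm_of_real abs_of_nonneg zero_le_power2)
    also have "\<dots> \<le> ip_norm ip f * ip_norm ip (fmult c ?X)"
      by (rule cauchy_schwarz[OF fH coordinate_mult_in[OF X(2)]])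
    also have "\<dots> = ip_norm ip f * ip_norm ip ?X" by (simp add: norm_coordinate_mult[OF X(2)])
    finally have "ip_norm ip ?X * ip_norm ip ?X \<le> ip_norm ip f * ip_norm ip ?X"
      by (simp add: power2_eq_square)
    then show ?thesis
      using norm_nonneg[OF X(2)] norm_nonneg[OF fH]
      by (cases "ip_norm ip ?X = 0") (auto simp: mult_le_cancel_right)
  qed
  then show "bounded_on (cfun.span kernel_funs) ip coordinate_adjoint"
    unfolding bounded_on_def by blast
qed

end

section \<open>Generic fibres of an inner toral curve\<close>

lemma eval2_simps [simp]:
  "eval2 0 x = 0" "eval2 1 x = 1" "eval2 (p + q) x = eval2 p x + eval2 q x"
  "eval2 (p * q) x = eval2 p x * eval2 q x" "eval2 [:r:] x = poly r (fst x)"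
  by (simp_all add: eval2_def)

lemma eval2_pCons: "eval2 (pCons a p) x = poly a (fst x) + snd x * eval2 p x"
  by (simp add: eval2_def)

lemma eval2_smult [simp]: "eval2 (smult a p) x = poly a (fst x) * eval2 p x"
  by (simp add: eval2_def)

lemma eval2_sum: "eval2 (sum f A) x = (\<Sum>i\<in>A. eval2 (f i) x)"
  by (induction A rule: infinite_finite_induct) simp_all

lemma eval2_prod: "eval2 (prod f A) x = (\<Prod>i\<in>A. eval2 (f i) x)"
  by (induction A rule: infinite_finite_induct) simp_all

lemma eval2_of_int: "eval2 (of_int k) x = of_int k"
  by (simp add: eval2_def of_int_poly)

lemma eval2_fixed_fst: "eval2 p (l, w) = poly (map_poly (\<lambda>a. poly a l) p) w"
  by (induction p) (simp_all add: eval2_pCons map_poly_pCons)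

lemma eval2_fixed_snd: "eval2 p (z, l) = poly (poly p [:l:]) z"
  by (simp add: eval2_def)

lemma eval2_dvd: "p dvd d \<Longrightarrow> eval2 p x = 0 \<Longrightarrow> eval2 d x = 0"
  by (auto elim!: dvdE)

text \<open>
  Over the fraction field of the coefficients \<open>p\<close> and \<open>d\<close> are coprime, and clearing denominators
  in a Bezout identity gives the claim. The proof realises this by pseudo-division: an element
  \<open>g \<noteq> 0\<close> of least degree in the ideal \<open>(p, d)\<close> divides every element of the ideal up to a
  constant, and this forces \<open>g\<close> to be constant since \<open>p\<close> is prime and does not divide \<open>d\<close>.
\<close>

lemma prime_elem_ideal_contains_constant:
  fixes p d :: "'a::idom poly"
  assumes p: "prime_elem p" "degree p > 0" and d: "\<not> p dvd d"
  obtains A B r where "r \<noteq> 0" "A * p + B * d = [:r:]"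
proof -
  define I where "I = {g. \<exists>A B. g = A * p + B * d}"
  have pI: "p \<in> I" unfolding I_def by (intro CollectI exI[of _ 1] exI[of _ 0]) simp
  have dI: "d \<in> I" unfolding I_def by (intro CollectI exI[of _ 0] exI[of _ 1]) simp
  have comb: "a * f + b * g \<in> I" if fg: "f \<in> I" "g \<in> I" for a b f g
  proof -
    obtain A B A' B' where "f = A * p + B * d" "g = A' * p + B' * d" using fg unfolding I_def by blast
    then have "a * f + b * g = (a * A + b * A') * p + (a * B + b * B') * d" by (simp add: algebra_simps)
    then show ?thesis unfolding I_def by blast
  qed
  have "\<exists>g. g \<in> I \<and> g \<noteq> 0" using pI p by auto
  then obtain g where g: "g \<in> I" "g \<noteq> 0" and min: "\<And>f. f \<in> I \<Longrightarrow> f \<noteq> 0 \<Longrightarrow> degree g \<le> degree f"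
    using ex_has_least_nat[of "\<lambda>g. g \<in> I \<and> g \<noteq> 0" _ degree] by blast
  have divides: "\<exists>a q. a \<noteq> 0 \<and> smult a f = g * q" if f: "f \<in> I" for f
  proof -
    define r where "r = pseudo_mod f g"
    obtain a q where aq: "a \<noteq> 0" "smult a f = g * q + r" using pseudo_mod(1)[OF g(2), of f] r_def by blast
    have "r = [:a:] * f + (- q) * g" using aq(2) by (simp add: algebra_simps)
    then have "r \<in> I" using comb[OF f g(1)] by metis
    then have "r = 0" using pseudo_mod(2)[OF g(2), of f, folded r_def] min leD by blast
    then show ?thesis using aq by auto
  qed
  obtain a q where aq: "a \<noteq> 0" "smult a p = g * q" using divides[OF pI] by blast
  have "p dvd g * q" using aq(2) by (metis dvd_smult dvd_refl)
  then have "p dvd g \<or> p dvd q" using prime_elem_dvd_multD[OF p(1)] by blast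
  then have "degree g = 0"
  proof
    assume "p dvd g"
    obtain b q' where b: "b \<noteq> 0" "smult b d = g * q'" using divides[OF dI] by blast
    have "p dvd [:b:] * d" using b(2) \<open>p dvd g\<close> by simp
    then have "p dvd [:b:]" using prime_elem_dvd_multD[OF p(1)] d by blast
    then show ?thesis using dvd_imp_degree_le[of p "[:b:]"] b(1) p(2) by simp
  next
    assume "p dvd q"
    then obtain s where s: "q = p * s" by (auto elim: dvdE)
    have "p * [:a:] = p * (g * s)" using aq(2) s by (simp add: mult_ac)
    then have "[:a:] = g * s" using p(1) by (simp only: mult_cancel_left) auto
    then have "degree g + degree s = 0" using degree_mult_eq[of g s] aq(1) g(2)
      by (metis degree_pCons_0 mult_zero_right pCons_eq_0_iff)
    then show ?thesis by simp
  qed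
  then obtain r where r: "g = [:r:]" using degree_eq_zeroE by blast
  then show ?thesis using g that[of r] by (auto simp: I_def)
qed

lemma inner_toral_zero_in_disk_iff:
  assumes "inner_toral p" "eval2 p (z, w) = 0"
  shows "z \<in> unit_disk \<longleftrightarrow> w \<in> unit_disk"
proof -
  have "(z, w) \<in> zero_set p" using assms(2) by (simp add: zero_set_def)
  then have "(z, w) \<in> unit_disk \<times> unit_disk \<union> sphere 0 1 \<times> sphere 0 1 \<union> (- cball 0 1) \<times> (- cball 0 1)"
    using assms(1) unfolding inner_toral_def by blast
  then show ?thesis by auto
qed

text \<open>
  \<open>p(l, \<cdot>)\<close> is not the zero polynomial, because it has no zero outside the disk.
\<close>

lemma inner_toral_fst_fibre_finite:
  assumes "inner_toral p" "l \<in> unit_disk"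
  shows "finite {w. eval2 p (l, w) = 0}"
proof -
  have "eval2 p (l, 2) \<noteq> 0"
    using inner_toral_zero_in_disk_iff[OF assms(1), of l 2] assms(2) by auto
  then have "map_poly (\<lambda>a. poly a l) p \<noteq> 0" by (auto simp: eval2_fixed_fst)
  then show ?thesis unfolding eval2_fixed_fst by (rule poly_roots_finite)
qed

text \<open>
  The first coordinates of the common zeros are roots of a polynomial in \<open>z\<close> alone, and the fibres
  over them are finite.
\<close>

lemma common_zeros_finite:
  assumes p: "irreducible p" "inner_toral p" "degree p > 0" and d: "\<not> p dvd d"
  shows "finite {x \<in> disk_variety p. eval2 d x = 0}"
proof -
  have "prime_elem p" using p(1) by (rule irreducible_imp_prime_elem)
  then obtain A B r where r: "r \<noteq> 0" "A * p + B * d = [:r:]"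
    using prime_elem_ideal_contains_constant p(3) d by metis
  have "{x \<in> disk_variety p. eval2 d x = 0} \<subseteq>
      (SIGMA l : {l \<in> unit_disk. poly r l = 0}. {w. eval2 p (l, w) = 0})"
  proof
    fix x assume x: "x \<in> {x \<in> disk_variety p. eval2 d x = 0}"
    then have "eval2 (A * p + B * d) x = 0" by (simp add: disk_variety_def zero_set_def)
    then have "poly r (fst x) = 0" unfolding r(2) by simp
    then show "x \<in> (SIGMA l : {l \<in> unit_disk. poly r l = 0}. {w. eval2 p (l, w) = 0})"
      using x by (auto simp: disk_variety_def zero_set_def)
  qed
  moreover have "finite {l \<in> unit_disk. poly r l = 0}"
    using poly_roots_finite[OF r(1)] by (rule rev_finite_subset) auto
  then have "finite (SIGMA l : {l \<in> unit_disk. poly r l = 0}. {w. eval2 p (l, w) = 0})"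
    using inner_toral_fst_fibre_finite[OF p(2)] by (intro finite_SigmaI) auto
  ultimately show ?thesis by (rule finite_subset)
qed

lemma card_roots_rsquarefree:
  fixes q :: "complex poly"
  assumes "q \<noteq> 0" "\<And>w. poly q w = 0 \<Longrightarrow> poly (pderiv q) w \<noteq> 0"
  shows "card {w. poly q w = 0} = degree q"
proof -
  have "rsquarefree q" using assms by (auto simp: rsquarefree_roots)
  then have "smult (lead_coeff q) (\<Prod>z|poly q z = 0. [:-z, 1:]) = q"
    by (rule complex_poly_decompose_rsquarefree)
  then have "degree q = degree (\<Prod>z|poly q z = 0. [:-z, 1:])"
    using assms(1) by (metis degree_smult_eq leading_coeff_0_iff)
  also have "\<dots> = card {w. poly q w = 0}"
    by (subst degree_prod_sum_eq) auto
  finally show ?thesis by simp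
qed

text \<open>
  The polynomial \<open>p(l, \<cdot>)\<close> has full degree unless its leading coefficient vanishes at \<open>l\<close>, its
  multiple roots are common zeros of \<open>p\<close> and \<open>\<partial>p/\<partial>w\<close>, and all its roots lie in the disk.
\<close>

lemma generic_fst_fibre:
  assumes p: "irreducible p" "inner_toral p" "deg_w p > 0"
  shows "\<exists>E. finite E \<and> (\<forall>l \<in> unit_disk - E. card {x \<in> disk_variety p. fst x = l} = deg_w p)"
proof -
  have deg: "degree p > 0" using p(3) by (simp add: deg_w_def)
  have "\<not> p dvd pderiv p"
    using dvd_imp_degree_le[of p "pderiv p"] degree_pderiv[of p] pderiv_eq_0_iff[of p] deg by auto
  note fin = common_zeros_finite[OF p(1,2) deg this]
  define E where "E = fst ` {x \<in> disk_variety p. eval2 (pderiv p) x = 0} \<union> {l. poly (lead_coeff p) l = 0}"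
  have "finite {l. poly (lead_coeff p) l = 0}" using deg by (intro poly_roots_finite) auto
  then have "finite E" using fin by (simp add: E_def)
  moreover have "card {x \<in> disk_variety p. fst x = l} = deg_w p" if l: "l \<in> unit_disk - E" for l
  proof -
    define q where "q = map_poly (\<lambda>a. poly a l) p"
    have coeff_q: "coeff q k = poly (coeff p k) l" for k by (simp add: q_def coeff_map_poly)
    have degree_q: "degree q = degree p"
    proof (rule antisym)
      show "degree q \<le> degree p" unfolding q_def by (rule map_poly_degree_leq)
      show "degree p \<le> degree q" using l by (intro le_degree) (auto simp: coeff_q E_def)
    qed
    have "pderiv q = map_poly (\<lambda>a. poly a l) (pderiv p)"
      by (rule poly_eqI) (simp add: coeff_pderiv coeff_q coeff_map_poly)
    then have deriv: "poly (pderiv q) w = eval2 (pderiv p) (l, w)" for w by (simp add: eval2_fixed_fst)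
    have zero: "poly q w = 0 \<longleftrightarrow> (l, w) \<in> disk_variety p" for w
      using inner_toral_zero_in_disk_iff[OF p(2), of l w] l
      by (auto simp: q_def eval2_fixed_fst[symmetric] disk_variety_def zero_set_def)
    have "card {w. poly q w = 0} = degree q"
    proof (rule card_roots_rsquarefree)
      show "q \<noteq> 0" using degree_q deg by auto
      show "poly (pderiv q) w \<noteq> 0" if "poly q w = 0" for w
        using that l unfolding zero deriv E_def by force
    qed
    moreover have "{x \<in> disk_variety p. fst x = l} = Pair l ` {w. poly q w = 0}"
      unfolding zero by force
    ultimately show ?thesis by (simp add: card_image inj_on_def degree_q deg_w_def)
  qed
  ultimately show ?thesis by blast
qed

lemma deg_z_witness:
  obtains i where "degree (coeff p i) = deg_z p" "p \<noteq> 0 \<longrightarrow> coeff p i \<noteq> 0"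
proof -
  have "deg_z p \<in> (\<lambda>i. degree (coeff p i)) ` {..degree p}"
    unfolding deg_z_def by (rule Max_in) auto
  then obtain i where i: "degree (coeff p i) = deg_z p" by auto
  show ?thesis
  proof (cases "deg_z p = 0")
    case True
    have "degree (coeff p (degree p)) \<le> deg_z p" unfolding deg_z_def by (rule Max_ge) auto
    then show ?thesis using True that[of "degree p"] by auto
  next
    case False
    then have "coeff p i \<noteq> 0" using i by (metis degree_0)
    then show ?thesis using i that[of i] by auto
  qed
qed

lemma degree_coeff_le_deg_z: "degree (coeff p i) \<le> deg_z p"
proof (cases "i \<le> degree p")
  case True
  then show ?thesis unfolding deg_z_def by (intro Max_ge) auto
qed (simp add: coeff_eq_0)

text \<open>
  Comparing degrees in \<open>w\<close>, a cofactor \<open>s\<close> with \<open>\<partial>p/\<partial>z = p s\<close> would be a polynomial in \<open>z\<close>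
  alone; then a coefficient of \<open>p\<close> of positive degree in \<open>z\<close> would divide its own derivative.
\<close>

lemma not_dvd_z_derivative:
  assumes "deg_z p > 0"
  shows "\<not> p dvd map_poly pderiv p"
proof
  assume "p dvd map_poly pderiv p"
  then obtain s where s: "map_poly pderiv p = p * s" by (auto elim: dvdE)
  obtain i where i: "degree (coeff p i) = deg_z p" using deg_z_witness .
  have "coeff (map_poly pderiv p) i \<noteq> 0" using i assms by (simp add: coeff_map_poly pderiv_eq_0_iff)
  then have nz: "p \<noteq> 0" "s \<noteq> 0" using s by auto
  have "degree (p * s) \<le> degree p"
    unfolding s[symmetric] by (rule map_poly_degree_leq)
  then have "degree s = 0" using degree_mult_eq[OF nz] by simp
  then obtain t where t: "s = [:t:]" by (rule degree_eq_zeroE)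
  have "pderiv (coeff p i) = coeff p i * t"
    using arg_cong[OF s, of "\<lambda>q. coeff q i"] by (simp add: coeff_map_poly t mult.commute)
  then have "degree (coeff p i) - 1 = degree (coeff p i) + degree t"
    using nz t i assms by (metis degree_0 degree_mult_eq degree_pderiv less_irrefl pCons_0_0)
  then show False using i assms by simp
qed

lemma poly_poly_pderiv: "poly (map_poly pderiv p) [:l:] = pderiv (poly p [:l:])"
  by (induction p) (simp_all add: map_poly_pCons pderiv_add pderiv_smult)

lemma coeff_poly_const: "coeff (poly p [:l:]) k = poly (map_poly (\<lambda>a. coeff a k) p) l"
  by (induction p) (simp_all add: map_poly_pCons)

text \<open>
  The same argument in the other variable. The coefficient of \<open>z\<^sup>n\<close> is now the polynomial in \<open>w\<close>
  that collects the coefficients of \<open>z\<^sup>n\<close> in the coefficients of \<open>p\<close>.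
\<close>

lemma generic_snd_fibre:
  assumes p: "irreducible p" "inner_toral p" "deg_w p > 0" "deg_z p > 0"
  shows "\<exists>E. finite E \<and> (\<forall>l \<in> unit_disk - E. card {x \<in> disk_variety p. snd x = l} = deg_z p)"
proof -
  have deg: "degree p > 0" using p(3) by (simp add: deg_w_def)
  note fin = common_zeros_finite[OF p(1,2) deg not_dvd_z_derivative[OF p(4)]]
  \<comment> \<open>the coefficient of the highest power of \<open>z\<close>, as a polynomial in \<open>w\<close>\<close>
  define lc where "lc = map_poly (\<lambda>a. coeff a (deg_z p)) p"
  obtain i where i: "degree (coeff p i) = deg_z p" "p \<noteq> 0 \<longrightarrow> coeff p i \<noteq> 0"
    by (rule deg_z_witness[of p])
  have "coeff lc i = lead_coeff (coeff p i)" unfolding i(1) by (simp add: lc_def coeff_map_poly)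
  then have "lc \<noteq> 0" using i(2) deg by (metis coeff_0 degree_0 leading_coeff_0_iff less_irrefl)
  define E where "E = snd ` {x \<in> disk_variety p. eval2 (map_poly pderiv p) x = 0} \<union> {l. poly lc l = 0}"
  have "finite E" using fin poly_roots_finite[OF \<open>lc \<noteq> 0\<close>] by (simp add: E_def)
  moreover have "card {x \<in> disk_variety p. snd x = l} = deg_z p" if l: "l \<in> unit_disk - E" for l
  proof -
    define q where "q = poly p [:l:]"
    have degree_q: "degree q = deg_z p"
    proof (rule antisym)
      show "degree q \<le> deg_z p"
      proof (rule degree_le, intro allI impI)
        fix k assume k: "deg_z p < k"
        have "map_poly (\<lambda>a. coeff a k) p = 0"
          using le_less_trans[OF degree_coeff_le_deg_z k]
          by (intro poly_eqI) (auto simp: coeff_map_poly coeff_eq_0)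
        then show "coeff q k = 0" by (simp add: q_def coeff_poly_const)
      qed
      show "deg_z p \<le> degree q"
        using l by (intro le_degree) (simp add: q_def coeff_poly_const E_def lc_def)
    qed
    have deriv: "poly (pderiv q) z = eval2 (map_poly pderiv p) (z, l)" for z
      by (simp add: eval2_fixed_snd poly_poly_pderiv q_def)
    have zero: "poly q z = 0 \<longleftrightarrow> (z, l) \<in> disk_variety p" for z
      using inner_toral_zero_in_disk_iff[OF p(2), of z l] l
      by (auto simp: q_def eval2_fixed_snd[symmetric] disk_variety_def zero_set_def)
    have "card {z. poly q z = 0} = degree q"
    proof (rule card_roots_rsquarefree)
      show "q \<noteq> 0" using degree_q p(4) by auto
      show "poly (pderiv q) z \<noteq> 0" if "poly q z = 0" for z
        using that l unfolding zero deriv E_def by force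
    qed
    moreover have "{x \<in> disk_variety p. snd x = l} = (\<lambda>z. (z, l)) ` {z. poly q z = 0}"
      unfolding zero by force
    ultimately show ?thesis by (simp add: card_image inj_on_def degree_q)
  qed
  ultimately show ?thesis by blast
qed

lemma full_rank_right_inverse:
  fixes A :: "complex^'n^'m"
  assumes "rank A = CARD('m)"
  obtains B :: "complex^'m^'n" where "A ** B = mat 1"
proof -
  have rows: "rows A = range (\<lambda>i. row i A)" by (auto simp: rows_def)
  have dim: "vec.dim (rows A) = CARD('m)" using assms by (simp add: row_rank_def_gen)
  have "vec.dim (rows A) \<le> card (rows A)"
    by (rule vec.dim_le_card) (auto simp: rows vec.span_superset)
  moreover have "card (rows A) \<le> CARD('m)" unfolding rows by (rule card_image_le) simp
  ultimately have card: "card (rows A) = CARD('m)" using dim by simp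
  have inj: "inj (\<lambda>i. row i A)" using card unfolding rows by (rule eq_card_imp_inj_on[rotated]) simp
  have indep: "vec.independent (rows A)"
  proof (rule vec.card_le_dim_spanning[where V = "rows A"])
    show "finite (rows A)" by (simp add: rows)
    show "card (rows A) \<le> vec.dim (rows A)" by (simp only: card dim)
  qed (simp_all add: vec.span_superset)
  have "\<forall>c. (\<Sum>i\<in>UNIV. c i *s row i A) = 0 \<longrightarrow> (\<forall>i. c i = 0)"
  proof (intro allI impI)
    fix c i assume "(\<Sum>i\<in>UNIV. c i *s row i A) = 0"
    then have "(\<Sum>v\<in>rows A. c (inv (\<lambda>i. row i A) v) *s v) = 0"
      unfolding rows by (simp add: sum.reindex[OF inj] inv_f_f[OF inj])
    then have "c (inv (\<lambda>i. row i A) (row i A)) = 0"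
      using vec.independentD[OF indep _ order_refl, of "\<lambda>v. c (inv (\<lambda>i. row i A) v)" "row i A"]
      by (auto simp: rows)
    then show "c i = 0" by (simp only: inv_f_f[OF inj])
  qed
  then show ?thesis using that matrix_right_invertible_independent_rows by blast
qed

text \<open>
  A right inverse \<open>B\<close> of \<open>A(x\<^sub>0)\<close> turns full rank into the non-vanishing of the single polynomial
  \<open>det (A B)\<close>, which is \<open>1\<close> at \<open>x\<^sub>0\<close> and hence is not a multiple of \<open>p\<close>.
\<close>

lemma full_rank_off_finite:
  fixes A :: "complex poly poly^'n^'m"
  assumes p: "irreducible p" "inner_toral p" "deg_w p > 0"
    and x0: "x0 \<in> disk_variety p" "rank (meval A x0) = CARD('m)"
  shows "finite {x \<in> disk_variety p. \<exists>\<gamma>. \<gamma> \<noteq> 0 \<and> cadjoint (meval A x) *v \<gamma> = 0}"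
proof -
  obtain B where B: "meval A x0 ** B = mat 1" using full_rank_right_inverse[OF x0(2)] .
  define d where "d = det (A ** map_matrix (\<lambda>b. [:[:b:]:]) B)"
  have eval_d: "eval2 d x = det (meval A x ** B)" for x
    by (simp add: d_def det_def eval2_sum eval2_prod eval2_of_int matrix_matrix_mult_def meval_def mult.commute)
  have "eval2 d x0 \<noteq> 0" by (simp add: eval_d B)
  moreover have "eval2 p x0 = 0" using x0 by (simp add: disk_variety_def zero_set_def)
  ultimately have "\<not> p dvd d" using eval2_dvd by blast
  then have "finite {x \<in> disk_variety p. eval2 d x = 0}"
    using common_zeros_finite p by (simp add: deg_w_def)
  moreover have "\<gamma> = 0" if nonzero: "eval2 d x \<noteq> 0" and kernel: "cadjoint (meval A x) *v \<gamma> = 0" for x \<gamma>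
  proof -
    obtain N where N: "(meval A x ** B) ** N = mat 1"
      using nonzero unfolding eval_d invertible_det_nz[symmetric] invertible_right_inverse by blast
    have "cinner \<gamma> v = cinner 0 v" for v
    proof -
      have "v = meval A x *v ((B ** N) *v v)"
        by (simp add: matrix_vector_mul_assoc matrix_mul_assoc N)
      then have "cinner v \<gamma> = cinner ((B ** N) *v v) (cadjoint (meval A x) *v \<gamma>)"
        by (metis cinner_adjoint)
      then have "cinner v \<gamma> = 0" using kernel by simp
      then show ?thesis by (simp add: cinner_commute[of \<gamma> v])
    qed
    then show ?thesis by (rule cinner_eqI)
  qed
  then have "{x \<in> disk_variety p. \<exists>\<gamma>. \<gamma> \<noteq> 0 \<and> cadjoint (meval A x) *v \<gamma> = 0} \<subseteq>
      {x \<in> disk_variety p. eval2 d x = 0}" by blast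
  ultimately show ?thesis using finite_subset by blast
qed

section \<open>Full rank over a generic fibre\<close>

text \<open>
  A power combination of distinct numbers separates them: apply the polynomial that vanishes at all
  of them but one.
\<close>

lemma powers_separate_points:
  fixes h :: "'x \<Rightarrow> complex^'n"
  assumes F: "finite F" "inj_on a F" and zero: "\<And>k. (\<Sum>y\<in>F. a y ^ k *s h y) = 0" and x: "x \<in> F"
  shows "h x = 0"
proof -
  have poly_zero: "(\<Sum>y\<in>F. poly q (a y) *s h y) = 0" for q
  proof -
    have "(\<Sum>y\<in>F. poly q (a y) *s h y) = (\<Sum>y\<in>F. \<Sum>k\<le>degree q. coeff q k *s (a y ^ k *s h y))"
      by (simp add: poly_altdef vec.scale_sum_left)
    also have "\<dots> = (\<Sum>k\<le>degree q. coeff q k *s (\<Sum>y\<in>F. a y ^ k *s h y))"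
      unfolding vec.scale_sum_right by (rule sum.swap)
    finally show ?thesis by (simp add: zero)
  qed
  define q where "q = (\<Prod>y\<in>F - {x}. [:- a y, 1:])"
  have "poly q (a y) = 0" if "y \<in> F - {x}" for y
    using that F(1) by (auto simp: q_def poly_prod)
  then have "(\<Sum>y\<in>F. poly q (a y) *s h y) = poly q (a x) *s h x"
    using F(1) x by (subst sum.remove[of _ x]) (auto intro!: sum.neutral)
  moreover have "poly q (a x) \<noteq> 0"
    using F x by (auto simp: q_def poly_prod inj_on_def)
  ultimately show ?thesis using poly_zero[of q] by (simp add: vec.scale_eq_0_iff)
qed

text \<open>
  The double sum is the squared Hardy norm of \<open>\<Sum>\<^sub>y h(y) s\<^bsub>\<mu>(y)\<^esub>\<close>, whose Taylor coefficients are the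
  sums of the previous lemma.
\<close>

lemma szego_gram_definite:
  fixes h :: "'x \<Rightarrow> complex^'n"
  assumes F: "finite F" "inj_on \<mu> F" "\<And>x. x \<in> F \<Longrightarrow> \<mu> x \<in> unit_disk"
    and zero: "(\<Sum>x\<in>F. \<Sum>y\<in>F. szego (\<mu> y) (\<mu> x) * cinner (h y) (h x)) = 0" and x: "x \<in> F"
  shows "h x = 0"
proof -
  let ?s = "\<lambda>y. restr unit_disk (\<lambda>z. szego (\<mu> y) z *s h y)"
  define f where "f = (\<Sum>y\<in>F. ?s y)"
  have s: "?s y \<in> hardy_space" if "y \<in> F" for y using szego_in_hardy[OF F(3)[OF that]] .
  have f: "f \<in> hardy_space" unfolding f_def by (rule hardy.sum_in) (rule s)
  have taylor: "taylor_coeff f k = (\<Sum>y\<in>F. cnj (\<mu> y) ^ k *s h y)" for k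
  proof -
    have "taylor_coeff f k = (\<Sum>y\<in>F. taylor_coeff (?s y) k)"
      unfolding f_def by (rule taylor_coeff_sum) (rule s)
    also have "\<dots> = (\<Sum>y\<in>F. cnj (\<mu> y) ^ k *s h y)"
      by (intro sum.cong refl) (simp only: taylor_coeff_szego[OF F(3)])
    finally show ?thesis .
  qed
  have "hardy_ip f f = (\<Sum>x\<in>F. hardy_ip f (?s x))"
    unfolding f_def by (rule hardy.ip_sum_right[OF f[unfolded f_def] s])
  also have "\<dots> = (\<Sum>x\<in>F. cinner (f (\<mu> x)) (h x))"
    by (intro sum.cong refl hardy_reproducing F(3) f)
  also have "\<dots> = (\<Sum>x\<in>F. \<Sum>y\<in>F. szego (\<mu> y) (\<mu> x) * cinner (h y) (h x))"
  proof (rule sum.cong[OF refl])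
    fix x assume "x \<in> F"
    then have "f (\<mu> x) = (\<Sum>y\<in>F. szego (\<mu> y) (\<mu> x) *s h y)"
      using F(3) by (simp add: f_def sum_fun_apply restr_def)
    then show "cinner (f (\<mu> x)) (h x) = (\<Sum>y\<in>F. szego (\<mu> y) (\<mu> x) * cinner (h y) (h x))"
      by (simp add: cinner_sum cinner_scale)
  qed
  finally have "hardy_ip f f = 0" using zero by simp
  then have "f = 0" using f hardy.ip_definite by blast
  then have "(\<Sum>y\<in>F. cnj (\<mu> y) ^ k *s h y) = 0" for k
    unfolding taylor[symmetric] by (simp only: taylor_coeff_zero)
  moreover have "inj_on (\<lambda>y. cnj (\<mu> y)) F" using F(2) by (auto simp: inj_on_def)
  ultimately show ?thesis using powers_separate_points[OF F(1) _ _ x] by blast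
qed

text \<open>
  There are as many vectors \<open>Q(x)\<^sup>* e\<^sub>i\<close>, for \<open>x \<in> F\<close>, as the dimension of the space. If they are
  linearly independent, then they span it, and \<open>v\<close>, which is orthogonal to all of them, is zero.
  They are independent because their Gram matrix is, up to the factor \<open>d\<close>, the matrix
  \<open>P(x) P(y)\<^sup>* / (1 - \<mu>(x) \<mu>(y)\<^sup>*)\<close>, which is definite by the preceding lemma.
\<close>

lemma fibre_separates:
  fixes Q :: "'x \<Rightarrow> complex^'q^'a" and P :: "'x \<Rightarrow> complex^'r^'a"
  assumes F: "finite F" "inj_on \<mu> F" "\<And>x. x \<in> F \<Longrightarrow> \<mu> x \<in> unit_disk"
    and card: "card F * CARD('a) = CARD('q)" and "d \<noteq> 0"
    and gram: "\<And>x y. x \<in> F \<Longrightarrow> y \<in> F \<Longrightarrow> map_matrix (\<lambda>t. t / d) (Q x ** cadjoint (Q y)) =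
      map_matrix (\<lambda>t. t / (1 - \<mu> x * cnj (\<mu> y))) (P x ** cadjoint (P y))"
    and P: "\<And>x \<gamma>. x \<in> F \<Longrightarrow> cadjoint (P x) *v \<gamma> = 0 \<Longrightarrow> \<gamma> = 0"
    and v: "\<And>x. x \<in> F \<Longrightarrow> Q x *v v = 0"
  shows "v = 0"
proof -
  have combination_zero: "g x = 0"
    if zero: "(\<Sum>y\<in>F. cadjoint (Q y) *v g y) = 0" and x: "x \<in> F" for g x
  proof -
    define h where "h y = cadjoint (P y) *v g y" for y
    have "(\<Sum>y\<in>F. szego (\<mu> y) (\<mu> x) * cinner (h y) (h x)) = 0" if x: "x \<in> F" for x
    proof -
      have "szego (\<mu> y) (\<mu> x) * cinner (h y) (h x) = (1 / d) * cinner (Q x *v (cadjoint (Q y) *v g y)) (g x)"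
        if y: "y \<in> F" for y
      proof -
        have "szego (\<mu> y) (\<mu> x) * cinner (h y) (h x) =
            cinner (map_matrix (\<lambda>t. t / (1 - \<mu> x * cnj (\<mu> y))) (P x ** cadjoint (P y)) *v g y) (g x)"
          unfolding map_matrix_divide_mult
          by (simp add: cinner_scale szego_def h_def cinner_adjoint[symmetric] matrix_vector_mul_assoc mult.commute)
        also have "\<dots> = (1 / d) * cinner (Q x *v (cadjoint (Q y) *v g y)) (g x)"
          unfolding gram[OF x y, symmetric] map_matrix_divide_mult
          by (simp add: cinner_scale matrix_vector_mul_assoc)
        finally show ?thesis .
      qed
      then have "(\<Sum>y\<in>F. szego (\<mu> y) (\<mu> x) * cinner (h y) (h x)) =
          (1 / d) * cinner (Q x *v (\<Sum>y\<in>F. cadjoint (Q y) *v g y)) (g x)"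
        by (simp add: matrix_vector_mult_sum_right cinner_sum sum_divide_distrib)
      then show ?thesis by (simp add: zero)
    qed
    then have "h x = 0" using szego_gram_definite[OF F _ x, of h] by simp
    then show ?thesis using P[OF x] by (simp add: h_def)
  qed
  define b where "b = (\<lambda>(x, i). cadjoint (Q x) *v (axis i 1 :: complex^'a))"
  define S where "S = F \<times> (UNIV :: 'a set)"
  have S: "finite S" "card S = CARD('q)" using F(1) card by (simp_all add: S_def)
  have coefficients_zero: "f s = 0" if zero: "(\<Sum>s\<in>S. f s *s b s) = 0" and s: "s \<in> S" for f s
  proof -
    have "cadjoint (Q x) *v (\<chi> i. f (x, i)) = (\<Sum>i\<in>UNIV. f (x, i) *s b (x, i))" for x
      by (simp add: b_def matrix_mult_sum[of _ "\<chi> i. f (x, i)"] matrix_vector_mult_axis)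
    then have "(\<Sum>x\<in>F. cadjoint (Q x) *v (\<chi> i. f (x, i))) = (\<Sum>s\<in>S. f s *s b s)"
      by (simp add: S_def sum.cartesian_product)
    then have "(\<chi> i. f (fst s, i)) = 0"
      using combination_zero[of "\<lambda>x. \<chi> i. f (x, i)" "fst s"] zero s by (auto simp: S_def)
    then show ?thesis by (metis prod.collapse vec_lambda_beta zero_index)
  qed
  have inj: "inj_on b S"
  proof (rule inj_onI, rule ccontr)
    fix s t assume st: "s \<in> S" "t \<in> S" "b s = b t" "s \<noteq> t"
    have "(\<Sum>r\<in>S. ((if r = s then 1 else 0) - (if r = t then 1 else 0)) *s b r) = b s - b t"
      using S(1) st(1,2) by (simp add: vec.scale_left_diff_distrib sum_subtractf if_distrib[of "\<lambda>c. c *s _"] cong: if_cong)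
    then show False
      using coefficients_zero[of "\<lambda>r. (if r = s then 1 else 0) - (if r = t then 1 else 0)" s] st by simp
  qed
  have indep: "vec.independent (b ` S)"
  proof (rule vec.independent_if_scalars_zero)
    fix f w assume "(\<Sum>x\<in>b ` S. f x *s x) = 0" "w \<in> b ` S"
    then show "f w = 0" using coefficients_zero[of "f \<circ> b"] by (auto simp: sum.reindex[OF inj])
  qed (simp add: S(1))
  have "UNIV \<subseteq> vec.span (b ` S)"
    by (rule vec.card_ge_dim_independent[OF subset_UNIV indep])
      (simp add: card_image[OF inj] S(2) card_cart_basis)
  moreover have "vec.span (b ` S) \<subseteq> {w. cinner v w = 0}"
  proof (rule vec.span_minimal)
    show "b ` S \<subseteq> {w. cinner v w = 0}"
      using v by (auto simp: b_def S_def cinner_adjoint[symmetric])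
    show "vec.subspace {w. cinner v w = 0}"
      by (rule vec.subspaceI)
        (simp_all add: cinner_scale_right cinner_add_right)
  qed
  ultimately have "cinner v v = 0" by blast
  then show ?thesis by (simp add: cinner_self)
qed

section \<open>Admissible kernels over an inner toral curve\<close>

text \<open>
  On a fibre of \<open>c\<close> the denominator \<open>1 - c(x) c(y)\<^sup>*\<close> is constant, so the equality of the two
  factorizations compares the Gram matrix of \<open>Q\<close> with the Szego-weighted one of \<open>P\<close>. The two
  coordinates \<open>c\<close> and \<open>\<mu>\<close> enter with exchanged roles when \<open>P\<close> is treated.
\<close>

lemma all_but_finitely_many_fibres_separate:
  fixes V :: "'x set" and Q :: "'x \<Rightarrow> complex^'q^'a" and P :: "'x \<Rightarrow> complex^'r^'a"
  assumes disk: "\<And>x. x \<in> V \<Longrightarrow> \<mu> x \<in> unit_disk"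
    and coordinates: "\<And>x y. x \<in> V \<Longrightarrow> y \<in> V \<Longrightarrow> c x = c y \<Longrightarrow> \<mu> x = \<mu> y \<Longrightarrow> x = y"
    and card: "\<exists>E. finite E \<and> (\<forall>l \<in> unit_disk - E. card {x \<in> V. c x = l} * CARD('a) = CARD('q))"
    and gram: "\<And>x y. x \<in> V \<Longrightarrow> y \<in> V \<Longrightarrow>
      map_matrix (\<lambda>t. t / (1 - c x * cnj (c y))) (Q x ** cadjoint (Q y)) =
      map_matrix (\<lambda>t. t / (1 - \<mu> x * cnj (\<mu> y))) (P x ** cadjoint (P y))"
    and full_rank: "finite {x \<in> V. \<exists>\<gamma>. \<gamma> \<noteq> 0 \<and> cadjoint (P x) *v \<gamma> = 0}"
  shows "\<exists>E. finite E \<and> (\<forall>l \<in> unit_disk - E. \<forall>v. (\<forall>x\<in>V. c x = l \<longrightarrow> Q x *v v = 0) \<longrightarrow> v = 0)"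
proof -
  let ?bad = "{x \<in> V. \<exists>\<gamma>. \<gamma> \<noteq> 0 \<and> cadjoint (P x) *v \<gamma> = 0}"
  obtain E where E: "finite E" "\<forall>l \<in> unit_disk - E. card {x \<in> V. c x = l} * CARD('a) = CARD('q)"
    using card by (elim exE conjE)
  have "v = 0" if l: "l \<in> unit_disk - (E \<union> c ` ?bad)" and v: "\<forall>x\<in>V. c x = l \<longrightarrow> Q x *v v = 0" for l v
  proof -
    let ?F = "{x \<in> V. c x = l}"
    have card: "card ?F * CARD('a) = CARD('q)" by (rule bspec[OF E(2)]) (use l in simp)
    have "card ?F * CARD('a) > 0" unfolding card by (rule zero_less_card_finite)
    then have "card ?F > 0" by simp
    then have fin: "finite ?F" by (rule card_ge_0_finite)
    have "cmod (l * cnj l) < 1"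
      using l mult_strict_mono'[of "cmod l" 1 "cmod l" 1] by (simp add: norm_mult)
    then have d: "1 - l * cnj l \<noteq> 0" by force
    have inj: "inj_on \<mu> ?F" using coordinates by (auto intro!: inj_onI)
    show ?thesis
    proof (rule fibre_separates[where F = ?F and \<mu> = \<mu> and Q = Q and P = P and d = "1 - l * cnj l",
          OF fin inj _ card d])
      show "\<mu> x \<in> unit_disk" if "x \<in> ?F" for x using disk that by blast
      show "map_matrix (\<lambda>t. t / (1 - l * cnj l)) (Q x ** cadjoint (Q y)) =
          map_matrix (\<lambda>t. t / (1 - \<mu> x * cnj (\<mu> y))) (P x ** cadjoint (P y))"
        if "x \<in> ?F" "y \<in> ?F" for x y
        using gram[of x y] that by auto
      show "\<gamma> = 0" if "x \<in> ?F" "cadjoint (P x) *v \<gamma> = 0" for x \<gamma> using that l by blast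
      show "Q x *v v = 0" if "x \<in> ?F" for x using v that by blast
    qed
  qed
  moreover have "finite (E \<union> c ` ?bad)" using E(1) full_rank by simp
  ultimately show ?thesis by blast
qed

theorem theorem4p1:
  fixes p :: "complex poly poly" and n m :: nat
    and Q :: "complex poly poly^'q^'a" and P :: "complex poly poly^'r^'a"
    and K :: "complex \<times> complex \<Rightarrow> complex \<times> complex \<Rightarrow> complex^'a^'a"
    and H :: "(complex \<times> complex \<Rightarrow> complex^'a) set" and ip :: "(complex \<times> complex, 'a) fun_ip"
    and V :: "(complex \<times> complex) set"
  defines "V \<equiv> disk_variety p"
  assumes "irreducible p" and "inner_toral p" and "bidegree p = (n, m)"
    and "CARD('q) = m * CARD('a)" and "CARD('r) = n * CARD('a)"
    and "admissible_kernel p Q P K"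
    and "rkhs V K H ip"
  shows
    "(\<exists>X. linear_on (cfun.span {kernel_fun V K y \<gamma> | y \<gamma>. y \<in> V}) X \<and>
          (\<forall>l u \<gamma>. (l, u) \<in> V \<longrightarrow>
             X (kernel_fun V K (l, u) \<gamma>) = fscale (cnj l) (kernel_fun V K (l, u) \<gamma>)) \<and>
          bounded_on (cfun.span {kernel_fun V K y \<gamma> | y \<gamma>. y \<in> V}) ip X) \<and>
     (\<forall>j. \<forall>k\<ge>1. zQ V Q k j \<in> H) \<and>
     dense_in (hardy_space :: (complex \<Rightarrow> complex^'q) set) hardy_ip
       (cfun.span {restr unit_disk (\<lambda>z. szego l z *s (cadjoint (meval Q (l, u)) *v \<gamma>)) | l u \<gamma>.
          (l, u) \<in> V}) \<and>
     orthonormal_basis H ip (\<lambda>(k, j). zQ V Q k j) \<and>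
     (\<exists>S T. pure_isometry_on H ip S \<and> pure_isometry_on H ip T \<and>
        (\<forall>f \<in> cfun.span (range (\<lambda>(k, j). zQ V Q k j)). S f = fmult fst f \<and> T f = fmult snd f))"
proof -
  note p = \<open>irreducible p\<close> \<open>inner_toral p\<close>
  note admissible = \<open>admissible_kernel p Q P K\<close>[unfolded admissible_kernel_def, folded V_def]
  note cards = admissible[THEN conjunct1] admissible[THEN conjunct2, THEN conjunct1]
  have kernel: "K x y = map_matrix (\<lambda>t. t / (1 - fst x * cnj (fst y))) (meval Q x ** cadjoint (meval Q y)) \<and>
      K x y = map_matrix (\<lambda>t. t / (1 - snd x * cnj (snd y))) (meval P x ** cadjoint (meval P y))"
    if "x \<in> V" "y \<in> V" for x y
    using admissible[THEN conjunct2, THEN conjunct2, THEN conjunct1, rule_format, OF that] by simp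
  obtain x0 where x0: "x0 \<in> V" "rank (meval Q x0) = CARD('a)" "rank (meval P x0) = CARD('a)"
    using admissible[THEN conjunct2, THEN conjunct2, THEN conjunct2] by blast
  have pos: "deg_w p > 0" "deg_z p > 0"
    using cards zero_less_card_finite[where 'a = 'q] zero_less_card_finite[where 'a = 'r]
    by (simp_all del: zero_less_card_finite)
  have disk: "fst x \<in> unit_disk \<and> snd x \<in> unit_disk" if "x \<in> V" for x
    using that by (auto simp: V_def disk_variety_def)
  have gram: "map_matrix (\<lambda>t. t / (1 - fst x * cnj (fst y))) (meval Q x ** cadjoint (meval Q y)) =
      map_matrix (\<lambda>t. t / (1 - snd x * cnj (snd y))) (meval P x ** cadjoint (meval P y))"
    if "x \<in> V" "y \<in> V" for x y
    using kernel[OF that, THEN conjunct1, symmetric] kernel[OF that, THEN conjunct2] by (rule trans)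
  note full_rank = full_rank_off_finite[OF p pos(1) x0(1)[unfolded V_def]]
  have separate_z: "\<exists>E. finite E \<and>
      (\<forall>l \<in> unit_disk - E. \<forall>v. (\<forall>x\<in>V. fst x = l \<longrightarrow> meval Q x *v v = 0) \<longrightarrow> v = 0)"
  proof (rule all_but_finitely_many_fibres_separate[where \<mu> = snd and P = "meval P"])
    show "\<exists>E. finite E \<and> (\<forall>l \<in> unit_disk - E. card {x \<in> V. fst x = l} * CARD('a) = CARD('q))"
      using generic_fst_fibre[OF p pos(1), folded V_def] by (elim exE conjE) (intro exI conjI, assumption, simp add: cards)
    show "finite {x \<in> V. \<exists>\<gamma>. \<gamma> \<noteq> 0 \<and> cadjoint (meval P x) *v \<gamma> = 0}"
      unfolding V_def by (rule full_rank[OF x0(3)])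
    show "snd x \<in> unit_disk" if "x \<in> V" for x using disk[OF that] by simp
    show "x = y" if "fst x = fst y" "snd x = snd y" for x y :: "complex \<times> complex"
      using that by (rule prod_eqI)
  qed (rule gram)
  have separate_w: "\<exists>E. finite E \<and>
      (\<forall>l \<in> unit_disk - E. \<forall>v. (\<forall>x\<in>V. snd x = l \<longrightarrow> meval P x *v v = 0) \<longrightarrow> v = 0)"
  proof (rule all_but_finitely_many_fibres_separate[where \<mu> = fst and P = "meval Q"])
    show "\<exists>E. finite E \<and> (\<forall>l \<in> unit_disk - E. card {x \<in> V. snd x = l} * CARD('a) = CARD('r))"
      using generic_snd_fibre[OF p pos, folded V_def] by (elim exE conjE) (intro exI conjI, assumption, simp add: cards)
    show "finite {x \<in> V. \<exists>\<gamma>. \<gamma> \<noteq> 0 \<and> cadjoint (meval Q x) *v \<gamma> = 0}"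
      unfolding V_def by (rule full_rank[OF x0(2)])
    show "fst x \<in> unit_disk" if "x \<in> V" for x using disk[OF that] by simp
    show "x = y" if "snd x = snd y" "fst x = fst y" for x y :: "complex \<times> complex"
      using that(2,1) by (rule prod_eqI)
  qed (rule gram[symmetric])
  interpret rkhs V K H ip by fact
  interpret z: szego_factored_rkhs V K H ip fst "meval Q"
  proof unfold_locales
    show "fst x \<in> unit_disk" if "x \<in> V" for x using disk[OF that] by (rule conjunct1)
    show "K x y = map_matrix (\<lambda>t. t / (1 - fst x * cnj (fst y))) (meval Q x ** cadjoint (meval Q y))"
      if "x \<in> V" "y \<in> V" for x y using kernel[OF that] by (rule conjunct1)
  qed (rule separate_z)
  interpret w: szego_factored_rkhs V K H ip snd "meval P"
  proof unfold_locales
    show "snd x \<in> unit_disk" if "x \<in> V" for x using disk[OF that] by (rule conjunct2)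
    show "K x y = map_matrix (\<lambda>t. t / (1 - snd x * cnj (snd y))) (meval P x ** cadjoint (meval P y))"
      if "x \<in> V" "y \<in> V" for x y using kernel[OF that] by (rule conjunct2)
  qed (rule separate_w)
  have basis: "orthonormal_basis H ip (\<lambda>(k, j). zQ V Q k j)"
    using z.column_monomials_orthonormal_basis by (simp only: zQ_def)
  then have in_H: "zQ V Q k j \<in> H" for k j
    unfolding orthonormal_basis_def using rangeI[of "\<lambda>(k, j). zQ V Q k j" "(k, j)"] by auto
  have szego: "z.szego_vectors =
      {restr unit_disk (\<lambda>z. szego l z *s (cadjoint (meval Q (l, u)) *v \<gamma>)) | l u \<gamma>. (l, u) \<in> V}"
    unfolding z.szego_vectors_def split_paired_Ex fst_conv ..
  obtain X where X: "linear_on (cfun.span z.kernel_funs) X"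
    "\<And>y \<gamma>. y \<in> V \<Longrightarrow> X (kernel_fun V K y \<gamma>) = fscale (cnj (fst y)) (kernel_fun V K y \<gamma>)"
    "bounded_on (cfun.span z.kernel_funs) ip X"
    using z.kernel_scaling_bounded by blast
  show ?thesis
  proof (intro conjI allI impI)
    show "\<exists>X. linear_on (cfun.span z.kernel_funs) X \<and>
        (\<forall>l u \<gamma>. (l, u) \<in> V \<longrightarrow> X (kernel_fun V K (l, u) \<gamma>) = fscale (cnj l) (kernel_fun V K (l, u) \<gamma>)) \<and>
        bounded_on (cfun.span z.kernel_funs) ip X"
    proof (intro exI[of _ X] conjI allI impI)
      show "X (kernel_fun V K (l, u) \<gamma>) = fscale (cnj l) (kernel_fun V K (l, u) \<gamma>)"
        if "(l, u) \<in> V" for l u \<gamma>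
        using X(2)[OF that] by simp
    qed (rule X(1), rule X(3))
    show "zQ V Q k j \<in> H" for k j by (rule in_H)
    show "dense_in hardy_space hardy_ip (cfun.span {restr unit_disk
        (\<lambda>z. szego l z *s (cadjoint (meval Q (l, u)) *v \<gamma>)) | l u \<gamma>. (l, u) \<in> V})"
      unfolding szego[symmetric] by (rule z.szego_vectors_dense)
    show "orthonormal_basis H ip (\<lambda>(k, j). zQ V Q k j)" by (rule basis)
    show "\<exists>S T. pure_isometry_on H ip S \<and> pure_isometry_on H ip T \<and>
        (\<forall>f \<in> cfun.span (range (\<lambda>(k, j). zQ V Q k j)). S f = fmult fst f \<and> T f = fmult snd f)"
      by (intro exI[of _ "fmult fst"] exI[of _ "fmult snd"] conjI ballI refl
          z.coordinate_mult_pure_isometry w.coordinate_mult_pure_isometry)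
  qed
qed

end
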